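(* Assume that $\emptyset\neq G\subset\mathbb{R}^n$ is an open set, $0\le s\le 2$, and $1<p<\infty$. Fix a measurable function $R:G\to\mathbb{R}$ satisfying $0\le R(x)\le\operatorname{dist}(x,\partial G)$ for every $x\in G$. Then, if $\omega$ is an $A_p$ weight in $\mathbb{R}^n$, there exists a constant $C>0$ such that the inequality $$\int_G\int_G\frac{|M_R(f)(x)-M_R(f)(y)|^p}{(|x-y|+|R(x)-R(y)|)^{sp}}\,\omega(x-y)\,dy\,dx\le C\int_G\int_G\frac{|f(x)-f(y)|^p}{|x-y|^{sp}}\,\omega(x-y)\,dy\,dx$$ holds for every $f\in L^p(G)$. The constant $C$ depends only on $n$, $p$ and the $A_p$ constant of $\omega$.
   Context: Convention: $\operatorname{dist}(x,\partial G)=\infty$ if $x\in G=\mathbb{R}^n$. $B(x,r)$ is the open ball of center $x$ and radius $r$. For a measurable $R:G\to\mathbb{R}$ with $0\le R(x)\le\operatorname{dist}(x,\partial G)$ on $G$, and $f\in L^1_{\mathrm{loc}}(G)$, the operator $M_R$ is defined for every $x\in G$ by $$M_R(f)(x)=\sup_{0\le r\le R(x)}\frac{1}{|B(x,r)|}\int_{B(x,r)}|f(y)|\,dy,$$ where for $r=0$ the average is by convention equal to $|f(x)|$. A weight in $\mathbb{R}^n$ is a function $\omega\in L^1_{\mathrm{loc}}(\mathbb{R}^n)$ with $\omega(x)>0$ for almost every $x$. For $1<p<\infty$, a weight $\omega$ is an $A_p$ weight if there is $A>0$ such that for every cube $Q\subset\mathbb{R}^n$ $$\Big(\frac1{|Q|}\int_Q\omega\,dx\Big)\Big(\frac1{|Q|}\int_Q\omega^{-1/(p-1)}\,dx\Big)^{p-1}\le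 A;$$ the infimum of such $A$ is the $A_p$ constant $[\omega]_{A_p}$. *)

theory Defs
  imports "HOL-Analysis.Analysis"
begin

text \<open>\<open>infdist x {} = 0\<close> in the library, so the case \<open>G = UNIV\<close>, in which the
  distance to the (empty) boundary is infinite, is separated.\<close>

definition dist_boundary :: "'a::metric_space \<Rightarrow> 'a set \<Rightarrow> ereal" where
  "dist_boundary x G = (if G = UNIV then \<infinity> else ereal (infdist x (frontier G)))"

text \<open>Real powers on \<open>[0, \<infinity>]\<close>; meant for positive exponents only.\<close>

definition ennreal_powr :: "ennreal \<Rightarrow> real \<Rightarrow> ennreal" where
  "ennreal_powr a q = (if a = \<infinity> then \<infinity> else ennreal (enn2real a powr q))"

text \<open>\<open>\<bar>a - b\<bar>\<close> on \<open>[0, \<infinity>]\<close>: subtraction is truncated, so one of the two summands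
  vanishes if \<open>a\<close> or \<open>b\<close> is finite.  If both are infinite, the value is \<open>\<infinity>\<close>.\<close>

definition ennreal_absdiff :: "ennreal \<Rightarrow> ennreal \<Rightarrow> ennreal" where
  "ennreal_absdiff a b = (a - b) + (b - a)"

definition Lp_on :: "real \<Rightarrow> (real^'n) set \<Rightarrow> (real^'n \<Rightarrow> real) set" where
  "Lp_on p G = {f \<in> borel_measurable (lebesgue_on G).
     (\<integral>\<^sup>+x\<in>G. ennreal (\<bar>f x\<bar> powr p) \<partial>lebesgue) < \<infinity>}"

definition ball_average :: "(real^'n \<Rightarrow> real) \<Rightarrow> real^'n \<Rightarrow> real \<Rightarrow> ennreal" where
  "ball_average f x r =
     (if r = 0 then ennreal \<bar>f x\<bar>
      else (\<integral>\<^sup>+y\<in>ball x r. ennreal \<bar>f y\<bar> \<partial>lebesgue) / emeasure lebesgue (ball x r))"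

text \<open>The operator \<open>M\<^sub>R\<close>; it takes values in \<open>[0, \<infinity>]\<close>.\<close>

definition maximal_op ::
    "(real^'n \<Rightarrow> real) \<Rightarrow> (real^'n \<Rightarrow> real) \<Rightarrow> real^'n \<Rightarrow> ennreal" where
  "maximal_op R f x = (SUP r\<in>{0..R x}. ball_average f x r)"

definition weight :: "(real^'n \<Rightarrow> real) \<Rightarrow> bool" where
  "weight \<omega> \<longleftrightarrow>
     (\<forall>K. compact K \<longrightarrow> \<omega> absolutely_integrable_on K) \<and> (AE x in lebesgue. \<omega> x > 0)"

definition cube :: "real^'n \<Rightarrow> real \<Rightarrow> (real^'n) set" where
  "cube a l = cbox a (\<chi> i. a $ i + l)"

definition cube_average :: "(real^'n \<Rightarrow> real) \<Rightarrow> (real^'n) set \<Rightarrow> ennreal" where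
  "cube_average g Q = (\<integral>\<^sup>+x\<in>Q. ennreal (g x) \<partial>lebesgue) / emeasure lebesgue Q"

definition Ap_bound :: "real \<Rightarrow> (real^'n \<Rightarrow> real) \<Rightarrow> real \<Rightarrow> bool" where
  "Ap_bound p \<omega> A \<longleftrightarrow> (\<forall>a l. l > 0 \<longrightarrow>
     cube_average \<omega> (cube a l) *
       ennreal_powr (cube_average (\<lambda>x. \<omega> x powr (- 1 / (p - 1))) (cube a l)) (p - 1)
     \<le> ennreal A)"

definition Ap_weight :: "real \<Rightarrow> (real^'n \<Rightarrow> real) \<Rightarrow> bool" where
  "Ap_weight p \<omega> \<longleftrightarrow> weight \<omega> \<and> (\<exists>A>0. Ap_bound p \<omega> A)"

definition Ap_const :: "real \<Rightarrow> (real^'n \<Rightarrow> real) \<Rightarrow> real" where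
  "Ap_const p \<omega> = Inf {A. A > 0 \<and> Ap_bound p \<omega> A}"

end

theory Submission
  imports Defs
begin

text \<open>
  Write \<open>F(x, y) = |f x - f y| / |x - y| powr s\<close> on \<open>G \<times> G\<close> and \<open>D = |x - y| + |R x - R y|\<close>.  For
  \<open>r \<le> R x\<close> the average of \<open>|f|\<close> over \<open>B(x, r)\<close> is compared with \<open>|f y|\<close> if \<open>r \<le> 2 D\<close>, and with
  the average over \<open>B(y, r - 2 D)\<close> otherwise.  In the second case both averages are parametrised
  over the unit ball, so that corresponding points \<open>a\<close>, \<open>b\<close> have distance at most \<open>3 D\<close>, and
  \<open>|f a - f b|\<close> is estimated by averaging over intermediate points in \<open>B(b, D)\<close>, a subset of \<open>B(x, r)\<close> and hence
  of \<open>G\<close>.  This bounds \<open>|M\<^sub>R f x - M\<^sub>R f y| / D powr s\<close> by maximal functions of \<open>F\<close> in the first variable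
  and along the diagonal of \<open>G \<times> G\<close>.  The diagonal one leaves \<open>x - y\<close> and thus the
  weight unchanged; the other one is bounded by Muckenhoupt's theorem, which is proved following
  Lerner: with \<open>\<sigma> = w powr (-1/(p-1))\<close>, the \<open>A\<^sub>p\<close> condition gives
  \<open>(M g) powr (p-1) \<le> A M\<^sub>w((M\<^sub>\<sigma> (g/\<sigma>)) powr (p-1) / w)\<close>, and \<open>M\<^sub>w\<close>, \<open>M\<^sub>\<sigma>\<close> are bounded by the Vitali
  covering lemma since both measures are doubling.
\<close>

subsection \<open>Powers in the extended nonnegative reals\<close>

text \<open>The obstacle is that the difference of corresponding points,
  \<open>a - b = (x - y) + 2 * D * z\<close>, moves with the parameter \<open>z\<close> of the unit
  ball, so the average of \<open>F a b\<close> over \<open>z\<close> is neither an average along a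
  diagonal nor one in a single variable. The intermediate point separates the two motions: averaging
  over it moves one argument of \<open>F\<close> only and allows that argument to be replaced by a
  point whose difference from the other one is \<open>x - y\<close> up to sign; averaging over
  \<open>z\<close> then runs along a diagonal. Of the loss \<open>2 * D\<close> in the radius, one
  \<open>D\<close> pays for the shift of the centre and one for the ball of intermediate points.
  With the second variable frozen, the weight is a translate of \<open>w\<close>, so Muckenhoupt's
  theorem has to hold with one constant for all translates; this is why explicit constants are
  carried along. All maximal functions run over one countable family of balls, which keeps iterated
  ones jointly measurable. The integrability of \<open>f\<close> makes its maximal function finite
  almost everywhere, and \<open>s <= 2\<close> makes the constant independent of
  \<open>s\<close>.\<close>

lemma ennreal_powr_ennreal [simp]: "0 \<le> a \<Longrightarrow> ennreal_powr (ennreal a) q = ennreal (a powr q)"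
  by (simp add: ennreal_powr_def)

lemma ennreal_powr_top [simp]: "ennreal_powr top q = top"
  by (simp add: ennreal_powr_def)

lemma ennreal_powr_0 [simp]: "ennreal_powr 0 q = 0"
  by (simp add: ennreal_powr_def)

lemma ennreal_powr_mono:
  assumes "0 \<le> q" "a \<le> b"
  shows "ennreal_powr a q \<le> ennreal_powr b q"
  using assms by (cases a; cases b) (auto intro!: ennreal_leI powr_mono2 simp: top_unique)

lemma ennreal_powr_powr: "ennreal_powr (ennreal_powr a p) q = ennreal_powr a (p * q)"
  by (cases a) (auto simp: powr_powr)

lemma ennreal_powr_one [simp]: "ennreal_powr a 1 = a"
  by (cases a) auto

lemma ennreal_powr_mult:
  assumes "0 < q"
  shows "ennreal_powr (a * b) q = ennreal_powr a q * ennreal_powr b q"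
  using assms
  by (cases a; cases b)
    (auto simp: powr_mult ennreal_mult[symmetric] ennreal_top_mult ennreal_mult_top)

lemma ennreal_powr_mult':
  assumes "0 < c"
  shows "ennreal_powr (ennreal c * b) q = ennreal (c powr q) * ennreal_powr b q"
  using assms by (cases b) (auto simp: powr_mult ennreal_mult[symmetric] ennreal_mult_top)

lemma ennreal_powr_le_iff:
  assumes "0 < q"
  shows "ennreal_powr a q \<le> b \<longleftrightarrow> a \<le> ennreal_powr b (1 / q)"
proof
  assume "ennreal_powr a q \<le> b"
  then have "ennreal_powr (ennreal_powr a q) (1 / q) \<le> ennreal_powr b (1 / q)"
    using assms by (intro ennreal_powr_mono) auto
  then show "a \<le> ennreal_powr b (1 / q)" using assms by (simp add: ennreal_powr_powr)
next
  assume "a \<le> ennreal_powr b (1 / q)"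
  then have "ennreal_powr a q \<le> ennreal_powr (ennreal_powr b (1 / q)) q"
    using assms by (intro ennreal_powr_mono) auto
  then show "ennreal_powr a q \<le> b" using assms by (simp add: ennreal_powr_powr)
qed

lemma ennreal_powr_measurable [measurable]:
  assumes [measurable]: "f \<in> borel_measurable M"
  shows "(\<lambda>x. ennreal_powr (f x) q) \<in> borel_measurable M"
  unfolding ennreal_powr_def by measurable

text \<open>The sum is at most twice its larger term, and the power of the larger term is one of the
  summands.\<close>

lemma ennreal_powr_add_le:
  assumes "0 \<le> q"
  shows "ennreal_powr (a + b) q \<le> ennreal (2 powr q) * (ennreal_powr a q + ennreal_powr b q)"
proof -
  have *: "ennreal_powr (u + v) q \<le> ennreal (2 powr q) * ennreal_powr v q" if "u \<le> v" for u v
  proof -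
    have "ennreal_powr (u + v) q \<le> ennreal_powr (2 * v) q"
      using that assms by (intro ennreal_powr_mono) (auto simp: mult_2 intro!: add_right_mono)
    also have "\<dots> = ennreal (2 powr q) * ennreal_powr v q"
      using ennreal_powr_mult'[of 2 v q] by simp
    finally show ?thesis .
  qed
  show ?thesis
  proof (cases "a \<le> b")
    case True
    from *[OF this] show ?thesis by (rule order.trans) (simp add: mult_left_mono add_increasing add_increasing2)
  next
    case False
    then have "b \<le> a" by simp
    from *[OF this] show ?thesis
      unfolding add.commute[of a b] by (rule order.trans) (simp add: mult_left_mono add_increasing add_increasing2)
  qed
qed

text \<open>Negative exponents above -1 are covered because \<open>p - 2\<close> occurs below, and
  \<open>p\<close> may be less than 2.\<close>

lemma nn_integral_powr_Ioo:
  assumes "-1 < a" "0 \<le> c"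
  shows "(\<integral>\<^sup>+t. ennreal (t powr a) * indicator {0<..<c} t \<partial>lborel)
    = ennreal (c powr (a + 1) / (a + 1))"
proof -
  have "((\<lambda>t. if t \<in> {0..c} then t powr a else 0) has_integral (c powr (a+1) / (a+1))) UNIV"
    using has_integral_powr_from_0[OF assms] by (subst has_integral_restrict_UNIV)
  from nn_integral_has_integral_lborel[OF _ _ this]
  have "(\<integral>\<^sup>+t. ennreal (if t \<in> {0..c} then t powr a else 0) \<partial>lborel) = ennreal (c powr (a+1) / (a+1))"
    by simp
  moreover have "(\<integral>\<^sup>+t. ennreal (t powr a) * indicator {0<..<c} t \<partial>lborel)
    = (\<integral>\<^sup>+t. ennreal (if t \<in> {0..c} then t powr a else 0) \<partial>lborel)"
    using AE_lborel_singleton[of 0] AE_lborel_singleton[of c]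
    by (intro nn_integral_cong_AE, eventually_elim) (auto simp: indicator_def)
  ultimately show ?thesis by simp
qed

text \<open>The integral of \<open>t powr (p - 1)\<close> up to \<open>h / 2\<close> is
  \<open>(h / 2) powr p / p\<close>, whence the factor in front. The level is \<open>2 * t\<close>
  because truncating a function at height \<open>t\<close> costs \<open>t\<close> in its maximal
  function and leaves \<open>t\<close> for the weak type inequality.\<close>

lemma ennreal_powr_layer_cake_le:
  fixes h :: ennreal
  assumes "0 < p"
  shows "ennreal_powr h p \<le>
    ennreal (2 powr p * p) * (\<integral>\<^sup>+t. ennreal (t powr (p - 1)) * indicator {0<..} t
      * (if ennreal (2 * t) < h then 1 else 0) \<partial>lborel)" (is "_ \<le> ?R h")
proof -
  have fin: "ennreal (a powr p) \<le> ?R h" if "0 \<le> a" "ennreal a \<le> h" for a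
  proof -
    have "ennreal (a powr p) = ennreal (2 powr p * p) * ennreal ((a/2) powr (p - 1 + 1) / (p - 1 + 1))"
      using assms that by (auto simp: ennreal_mult[symmetric] powr_divide)
    also have "\<dots> = ennreal (2 powr p * p) *
        (\<integral>\<^sup>+t. ennreal (t powr (p - 1)) * indicator {0<..<a/2} t \<partial>lborel)"
      using assms that by (subst nn_integral_powr_Ioo) auto
    also have "\<dots> \<le> ?R h"
      using that
      by (intro mult_left_mono nn_integral_mono)
        (auto simp: indicator_def ennreal_less_iff intro: less_le_trans[of _ "ennreal a"])
    finally show ?thesis .
  qed
  show ?thesis
  proof (cases h)
    case (real a)
    then show ?thesis using fin[of a] by simp
  next
    case top
    \<comment> \<open>If \<open>h\<close> is infinite, the finite case holds for every real
      \<open>a\<close>; this choice of \<open>a\<close> has \<open>a powr p = n\<close>.\<close>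
    have *: "of_nat n \<le> ?R h" for n
      using fin[of "real n powr (1 / p)"] assms top
      by (simp add: powr_powr ennreal_of_nat_eq_real_of_nat)
    have "(SUP n. of_nat n) \<le> ?R h" by (rule SUP_least) (rule *)
    then show ?thesis unfolding ennreal_SUP_of_nat_eq_top using top by (simp add: top_unique)
  qed
qed

text \<open>This is the inner integral that remains after Tonelli: the factor \<open>g\<close> comes
  from the integral in the weak type bound, and the division by \<open>t\<close> there lowers the
  exponent to \<open>p - 2\<close>.\<close>

lemma ennreal_layer_cake_ge:
  fixes g :: ennreal
  assumes "1 < p"
  shows "g * (\<integral>\<^sup>+t. ennreal (t powr (p - 2)) * indicator {0<..} t
      * (if ennreal t < g then 1 else 0) \<partial>lborel) \<le> ennreal (1 / (p - 1)) * ennreal_powr g p"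
proof (cases g)
  case (real a)
  have "(\<integral>\<^sup>+t. ennreal (t powr (p - 2)) * indicator {0<..} t
      * (if ennreal t < g then 1 else 0) \<partial>lborel)
    = (\<integral>\<^sup>+t. ennreal (t powr (p - 2)) * indicator {0<..<a} t \<partial>lborel)"
    using real by (intro nn_integral_cong) (auto simp: indicator_def ennreal_less_iff)
  also have "\<dots> = ennreal (a powr (p - 1) / (p - 1))"
    using assms real by (subst nn_integral_powr_Ioo) auto
  finally show ?thesis
    using real assms
    by (cases "a = 0") (auto simp: ennreal_mult[symmetric] powr_diff)
next
  case top
  then show ?thesis using assms by (simp add: ennreal_mult_top)
qed

subsection \<open>Maximal functions for doubling measures\<close>

text \<open>An uncentred maximal operator. The family of balls, given by centre and radius, is a
  parameter so that a countable one can be chosen; measurability is then that of a countable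
  supremum.\<close>

definition max_fun :: "'a::euclidean_space measure \<Rightarrow> ('a \<times> real) set \<Rightarrow> ('a \<Rightarrow> ennreal) \<Rightarrow> 'a \<Rightarrow> ennreal"
  where "max_fun \<mu> I g x =
    (SUP i\<in>I. indicator (ball (fst i) (snd i)) x *
      ((\<integral>\<^sup>+y\<in>ball (fst i) (snd i). g y \<partial>\<mu>) / emeasure \<mu> (ball (fst i) (snd i))))"

text \<open>The dilation factor 5 is that of the Vitali covering lemma.\<close>

definition doubling :: "real \<Rightarrow> 'a::euclidean_space measure \<Rightarrow> bool" where
  "doubling c \<mu> \<longleftrightarrow> sets \<mu> = sets borel \<and> 0 < c \<and> (\<forall>x r. 0 < r \<longrightarrow>
     0 < emeasure \<mu> (ball x r) \<and> emeasure \<mu> (ball x r) < \<infinity> \<and>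
     emeasure \<mu> (ball x (5 * r)) \<le> ennreal c * emeasure \<mu> (ball x r))"

lemma max_fun_upper:
  assumes "i \<in> I" "x \<in> ball (fst i) (snd i)"
  shows "(\<integral>\<^sup>+y\<in>ball (fst i) (snd i). g y \<partial>\<mu>) / emeasure \<mu> (ball (fst i) (snd i)) \<le> max_fun \<mu> I g x"
  unfolding max_fun_def using assms by (intro SUP_upper2[of i]) auto

lemma max_fun_least:
  assumes "\<And>i. i \<in> I \<Longrightarrow> x \<in> ball (fst i) (snd i) \<Longrightarrow>
    (\<integral>\<^sup>+y\<in>ball (fst i) (snd i). g y \<partial>\<mu>) / emeasure \<mu> (ball (fst i) (snd i)) \<le> b"
  shows "max_fun \<mu> I g x \<le> b"
  unfolding max_fun_def using assms by (intro SUP_least) (auto simp: indicator_def)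

lemma max_fun_measurable [measurable]:
  assumes "countable I"
  shows "max_fun \<mu> I g \<in> borel_measurable borel"
  unfolding max_fun_def[abs_def] using assms(1)
  by (intro borel_measurable_SUP borel_measurable_times_ennreal borel_measurable_indicator
      borel_measurable_const) auto

text \<open>The sum is an integral over \<open>count_space I\<close> because the Vitali lemma
  delivers a countable set of balls without an enumeration.\<close>

lemma emeasure_UN_countable_le:
  assumes "countable I" and [measurable]: "\<And>i. i \<in> I \<Longrightarrow> X i \<in> sets M"
  shows "emeasure M (\<Union>i\<in>I. X i) \<le> (\<integral>\<^sup>+i. emeasure M (X i) \<partial>count_space I)"
proof -
  have "emeasure M (\<Union>i\<in>I. X i) = (\<integral>\<^sup>+x. indicator (\<Union>i\<in>I. X i) x \<partial>M)"
    using assms by (intro nn_integral_indicator[symmetric] sets.countable_UN') auto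
  also have "\<dots> \<le> (\<integral>\<^sup>+x. (\<integral>\<^sup>+i. indicator (X i) x \<partial>count_space I) \<partial>M)"
  proof (intro nn_integral_mono)
    fix x
    show "indicator (\<Union>i\<in>I. X i) x \<le> (\<integral>\<^sup>+i. indicator (X i) x \<partial>count_space I :: ennreal)"
    proof (cases "x \<in> (\<Union>i\<in>I. X i)")
      case True
      then obtain j where j: "j \<in> I" "x \<in> X j" by auto
      have "1 = (\<integral>\<^sup>+i. indicator {j} i \<partial>count_space I :: ennreal)"
        using j by (subst nn_integral_indicator) auto
      also have "\<dots> \<le> (\<integral>\<^sup>+i. indicator (X i) x \<partial>count_space I)"
        using j by (intro nn_integral_mono) (auto simp: indicator_def)
      finally show ?thesis using True by simp
    qed auto
  qed
  also have "\<dots> = (\<integral>\<^sup>+i. (\<integral>\<^sup>+x. indicator (X i) x \<partial>M) \<partial>count_space I)"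
    using assms by (intro nn_integral_count_space_nn_integral) auto
  also have "\<dots> = (\<integral>\<^sup>+i. emeasure M (X i) \<partial>count_space I)"
    by (intro nn_integral_cong) auto
  finally show ?thesis .
qed

text \<open>The superlevel set is the union of the balls whose average exceeds \<open>t\<close>.
  Select disjoint ones whose fivefold dilates still cover: \<open>t\<close> times the measure of a
  dilate is at most \<open>c\<close> times the integral of \<open>g\<close> over the ball, and
  disjointness lets these integrals be summed.\<close>

lemma max_fun_weak_type:
  assumes \<mu>: "doubling c \<mu>" and I: "\<And>i. i \<in> I \<Longrightarrow> 0 < snd i"
    and [measurable]: "g \<in> borel_measurable borel"
    and t: "0 < t"
  shows "ennreal t * emeasure \<mu> {x. ennreal t < max_fun \<mu> I g x} \<le> ennreal c * (\<integral>\<^sup>+x. g x \<partial>\<mu>)"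
proof -
  have sets_eq [measurable_cong]: "sets \<mu> = sets borel" and c: "0 < c"
    using \<mu> by (auto simp: doubling_def)
  define B where "B i = ball (fst i :: 'a) (snd i)" for i
  define J where "J = {i\<in>I. ennreal t < (\<integral>\<^sup>+y\<in>B i. g y \<partial>\<mu>) / emeasure \<mu> (B i)}"
  have J: "{x. ennreal t < max_fun \<mu> I g x} = (\<Union>i\<in>J. B i)"
    unfolding max_fun_def less_SUP_iff J_def B_def by (auto simp: indicator_def split: if_splits)
  have Jt: "ennreal t * emeasure \<mu> (B i) \<le> (\<integral>\<^sup>+y\<in>B i. g y \<partial>\<mu>)" if "i \<in> J" for i
  proof -
    have e: "0 < emeasure \<mu> (B i)" "emeasure \<mu> (B i) < \<infinity>"
      using \<mu> I that by (auto simp: doubling_def B_def J_def)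
    have "ennreal t * emeasure \<mu> (B i) \<le> (\<integral>\<^sup>+y\<in>B i. g y \<partial>\<mu>) / emeasure \<mu> (B i) * emeasure \<mu> (B i)"
      using that by (intro mult_right_mono) (auto simp: J_def)
    also have "\<dots> = (\<integral>\<^sup>+y\<in>B i. g y \<partial>\<mu>)"
      using e by (intro ennreal_divide_times[THEN trans]) (auto simp: ennreal_divide_self mult_divide_eq_ennreal)
    finally show ?thesis .
  qed
  \<comment> \<open>The covering lemma needs bounded radii; continuity from below removes the bound
    \<open>n\<close> at the end.\<close>
  define K where "K n = {i\<in>J. snd i \<le> real n}" for n
  have Kn: "ennreal t * emeasure \<mu> (\<Union>i\<in>K n. B i) \<le> ennreal c * (\<integral>\<^sup>+x. g x \<partial>\<mu>)" for n
  proof -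
    have "\<And>i. i \<in> K n \<Longrightarrow> 0 < snd i \<and> snd i \<le> real n"
      using I by (auto simp: K_def J_def)
    from Vitali_covering_lemma_balls[where a = fst and r = snd and K = "K n"
        and S = "\<Union>i\<in>K n. B i", OF _ this]
    obtain C where C: "countable C" "C \<subseteq> K n" "pairwise (\<lambda>i j. disjnt (B i) (B j)) C"
        "(\<Union>i\<in>K n. B i) \<subseteq> (\<Union>i\<in>C. ball (fst i) (5 * snd i))"
      unfolding B_def by blast
    have CJ: "C \<subseteq> J" using C(2) by (auto simp: K_def)
    have "emeasure \<mu> (\<Union>i\<in>K n. B i) \<le> emeasure \<mu> (\<Union>i\<in>C. ball (fst i) (5 * snd i))"
      using C by (intro emeasure_mono sets.countable_UN') (auto simp: B_def)
    also have "\<dots> \<le> (\<integral>\<^sup>+i. emeasure \<mu> (ball (fst i) (5 * snd i)) \<partial>count_space C)"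
      using C by (intro emeasure_UN_countable_le) auto
    finally have "ennreal t * emeasure \<mu> (\<Union>i\<in>K n. B i)
        \<le> ennreal t * (\<integral>\<^sup>+i. emeasure \<mu> (ball (fst i) (5 * snd i)) \<partial>count_space C)"
      by (rule mult_left_mono) auto
    also have "\<dots> = (\<integral>\<^sup>+i. ennreal t * emeasure \<mu> (ball (fst i) (5 * snd i)) \<partial>count_space C)"
      by (simp add: nn_integral_cmult)
    also have "\<dots> \<le> (\<integral>\<^sup>+i. ennreal c * (\<integral>\<^sup>+y\<in>B i. g y \<partial>\<mu>) \<partial>count_space C)"
    proof (intro nn_integral_mono)
      fix i assume "i \<in> space (count_space C)"
      then have i: "i \<in> J" "0 < snd i" using CJ I[of i] by (auto simp: J_def)
      have "ennreal t * emeasure \<mu> (ball (fst i) (5 * snd i)) \<le> ennreal t * (ennreal c * emeasure \<mu> (B i))"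
        using \<mu> i by (intro mult_left_mono) (auto simp: doubling_def B_def)
      also have "\<dots> \<le> ennreal c * (\<integral>\<^sup>+y\<in>B i. g y \<partial>\<mu>)"
        using mult_left_mono[OF Jt[OF i(1)], of "ennreal c"] by (simp add: ac_simps)
      finally show "ennreal t * emeasure \<mu> (ball (fst i) (5 * snd i)) \<le> ennreal c * (\<integral>\<^sup>+y\<in>B i. g y \<partial>\<mu>)" .
    qed
    also have "\<dots> = ennreal c * (\<integral>\<^sup>+i. (\<integral>\<^sup>+y\<in>B i. g y \<partial>\<mu>) \<partial>count_space C)"
      by (simp add: nn_integral_cmult)
    also have "(\<integral>\<^sup>+i. (\<integral>\<^sup>+y\<in>B i. g y \<partial>\<mu>) \<partial>count_space C) = (\<integral>\<^sup>+y\<in>(\<Union>i\<in>C. B i). g y \<partial>\<mu>)"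
    proof -
      \<comment> \<open>As values of the measure with density \<open>g\<close>, the integrals over
        disjoint balls add up by countable additivity.\<close>
      have "(\<integral>\<^sup>+i. emeasure (density \<mu> g) (B i) \<partial>count_space C) = emeasure (density \<mu> g) (\<Union>i\<in>C. B i)"
        using C(1,3)
        by (intro emeasure_UN_countable[symmetric])
          (auto simp: B_def disjoint_family_on_def pairwise_def disjnt_def)
      moreover have "(\<Union>i\<in>C. B i) \<in> sets \<mu>"
        using C(1) by (intro sets.countable_UN') (auto simp: B_def)
      moreover have "B i \<in> sets \<mu>" for i by (simp add: B_def)
      ultimately show ?thesis
        by (simp add: emeasure_density)
    qed
    also have "\<dots> \<le> (\<integral>\<^sup>+y. g y \<partial>\<mu>)"
      by (intro nn_integral_mono) (auto simp: indicator_def)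
    finally show ?thesis by (simp add: mult_left_mono)
  qed
  have "emeasure \<mu> (\<Union>n. \<Union>i\<in>K n. B i) = (SUP n. emeasure \<mu> (\<Union>i\<in>K n. B i))"
  proof (rule SUP_emeasure_incseq[symmetric])
    show "range (\<lambda>n. \<Union>i\<in>K n. B i) \<subseteq> sets \<mu>"
      by (auto simp: B_def sets_eq intro!: borel_open open_UN)
    show "incseq (\<lambda>n. \<Union>i\<in>K n. B i)"
      by (auto simp: incseq_def K_def)
  qed
  moreover have "(\<Union>n. \<Union>i\<in>K n. B i) = (\<Union>i\<in>J. B i)"
    using real_arch_simple by (fastforce simp: K_def)
  ultimately show ?thesis
    unfolding J using Kn by (auto simp: SUP_mult_left_ennreal intro!: SUP_least)
qed

text \<open>Pointwise \<open>g\<close> is at most its part above height \<open>t\<close> plus the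
  constant \<open>t\<close>, and the average of the constant is \<open>t\<close>.\<close>

lemma max_fun_truncate:
  assumes \<mu>: "doubling c \<mu>" and I: "\<And>i. i \<in> I \<Longrightarrow> 0 < snd i"
    and [measurable]: "g \<in> borel_measurable borel"
  shows "max_fun \<mu> I g x \<le> max_fun \<mu> I (\<lambda>y. g y * indicator {y. ennreal t < g y} y) x + ennreal t"
proof (rule max_fun_least)
  have [measurable_cong]: "sets \<mu> = sets borel" using \<mu> by (auto simp: doubling_def)
  fix i assume i: "i \<in> I" "x \<in> ball (fst i) (snd i)"
  let ?B = "ball (fst i) (snd i)"
  let ?g = "\<lambda>y. g y * indicator {y. ennreal t < g y} y"
  have e: "0 < emeasure \<mu> ?B" "emeasure \<mu> ?B < \<infinity>"
    using \<mu> I[OF i(1)] by (auto simp: doubling_def)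
  have "(\<integral>\<^sup>+y\<in>?B. g y \<partial>\<mu>) \<le> (\<integral>\<^sup>+y. ?g y * indicator ?B y + ennreal t * indicator ?B y \<partial>\<mu>)"
    by (intro nn_integral_mono) (auto simp: indicator_def not_less)
  also have "\<dots> = (\<integral>\<^sup>+y\<in>?B. ?g y \<partial>\<mu>) + ennreal t * emeasure \<mu> ?B"
  proof -
    have "(\<lambda>y. ?g y * indicator ?B y) \<in> borel_measurable \<mu>"
         "(\<lambda>y. ennreal t * indicator ?B y) \<in> borel_measurable \<mu>" "?B \<in> sets \<mu>"
      using borel_open[OF open_ball, of "fst i" "snd i", measurable] by measurable
    from nn_integral_add[OF this(1,2)] this(3) show ?thesis
      by (simp only: nn_integral_cmult_indicator)
  qed
  finally have "(\<integral>\<^sup>+y\<in>?B. g y \<partial>\<mu>) / emeasure \<mu> ?B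
      \<le> ((\<integral>\<^sup>+y\<in>?B. ?g y \<partial>\<mu>) + ennreal t * emeasure \<mu> ?B) / emeasure \<mu> ?B"
    by (rule divide_right_mono_ennreal)
  also have "\<dots> = (\<integral>\<^sup>+y\<in>?B. ?g y \<partial>\<mu>) / emeasure \<mu> ?B + ennreal t"
    using e by (simp add: add_divide_distrib_ennreal mult_divide_eq_ennreal)
  also have "\<dots> \<le> max_fun \<mu> I ?g x + ennreal t"
    by (intro add_right_mono max_fun_upper i)
  finally show "(\<integral>\<^sup>+y\<in>?B. g y \<partial>\<mu>) / emeasure \<mu> ?B \<le> max_fun \<mu> I ?g x + ennreal t" .
qed

text \<open>By truncation the maximal function of the part of \<open>g\<close> above
  \<open>t\<close> exceeds \<open>t\<close> on this set, so the weak type inequality applies to that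
  part.\<close>

lemma max_fun_superlevel:
  assumes \<mu>: "doubling c \<mu>" and I: "\<And>i. i \<in> I \<Longrightarrow> 0 < snd i"
    and [measurable]: "g \<in> borel_measurable borel"
    and t: "0 < t" and cI: "countable I"
  shows "emeasure \<mu> {x. ennreal (2 * t) < max_fun \<mu> I g x}
    \<le> ennreal (c / t) * (\<integral>\<^sup>+x. g x * indicator {y. ennreal t < g y} x \<partial>\<mu>)"
proof -
  have [measurable_cong]: "sets \<mu> = sets borel" and c: "0 < c" using \<mu> by (auto simp: doubling_def)
  note max_fun_measurable[OF cI, measurable]
  let ?g = "\<lambda>y. g y * indicator {y. ennreal t < g y} y"
  have "emeasure \<mu> {x. ennreal (2 * t) < max_fun \<mu> I g x} \<le> emeasure \<mu> {x. ennreal t < max_fun \<mu> I ?g x}"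
  proof (intro emeasure_mono)
    show "{x. ennreal (2 * t) < max_fun \<mu> I g x} \<subseteq> {x. ennreal t < max_fun \<mu> I ?g x}"
    proof safe
      fix x assume "ennreal (2 * t) < max_fun \<mu> I g x"
      also have "\<dots> \<le> max_fun \<mu> I ?g x + ennreal t" by (rule max_fun_truncate[OF \<mu> I]) auto
      finally have "ennreal t + ennreal t < max_fun \<mu> I ?g x + ennreal t"
        using t by (simp flip: ennreal_plus)
      then show "ennreal t < max_fun \<mu> I ?g x"
        by (meson add_right_mono leD leI)
    qed
  qed measurable
  also have "\<dots> = ennreal (1 / t) * (ennreal t * emeasure \<mu> {x. ennreal t < max_fun \<mu> I ?g x})"
    using t by (simp add: mult.assoc[symmetric] ennreal_mult[symmetric])
  also have "\<dots> \<le> ennreal (1 / t) * (ennreal c * (\<integral>\<^sup>+x. ?g x \<partial>\<mu>))"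
    by (intro mult_left_mono max_fun_weak_type[OF \<mu> I _ t]) auto
  also have "\<dots> = ennreal (c / t) * (\<integral>\<^sup>+x. ?g x \<partial>\<mu>)"
    using t c by (simp add: mult.assoc[symmetric] ennreal_mult[symmetric])
  finally show ?thesis .
qed

text \<open>Marcinkiewicz interpolation between weak type (1,1) and the trivial bound for bounded
  functions, written out. In the constant, \<open>2 powr p * p\<close> stems from the layer cake
  formula, \<open>c\<close> from the weak type inequality and \<open>1 / (p - 1)\<close> from the
  inner integral in \<open>t\<close>.\<close>

lemma max_fun_strong_type:
  assumes \<mu>: "doubling c \<mu>" and I: "\<And>i. i \<in> I \<Longrightarrow> 0 < snd i" and cI: "countable I"
    and sf: "sigma_finite_measure \<mu>"
    and g[measurable]: "g \<in> borel_measurable borel" and p: "1 < p"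
  shows "(\<integral>\<^sup>+x. ennreal_powr (max_fun \<mu> I g x) p \<partial>\<mu>)
    \<le> ennreal (2 powr p * p * c / (p - 1)) * (\<integral>\<^sup>+x. ennreal_powr (g x) p \<partial>\<mu>)"
proof -
  have [measurable_cong]: "sets \<mu> = sets borel" and c: "0 < c" using \<mu> by (auto simp: doubling_def)
  note max_fun_measurable[OF cI, measurable]
  interpret sigma_finite_measure \<mu> by (rule sf)
  interpret pair_sigma_finite lborel \<mu> ..
  let ?M = "max_fun \<mu> I g"
  have "(\<integral>\<^sup>+x. ennreal_powr (?M x) p \<partial>\<mu>) \<le> (\<integral>\<^sup>+x. ennreal (2 powr p * p) *
      (\<integral>\<^sup>+t. ennreal (t powr (p - 1)) * indicator {0<..} t
      * (if ennreal (2 * t) < ?M x then 1 else 0) \<partial>lborel) \<partial>\<mu>)"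
    using p by (intro nn_integral_mono ennreal_powr_layer_cake_le) auto
  also have "\<dots> = ennreal (2 powr p * p) * (\<integral>\<^sup>+x. (\<integral>\<^sup>+t. ennreal (t powr (p - 1)) * indicator {0<..} t
      * (if ennreal (2 * t) < ?M x then 1 else 0) \<partial>lborel) \<partial>\<mu>)"
    by (rule nn_integral_cmult) measurable
  also have "(\<integral>\<^sup>+x. (\<integral>\<^sup>+t. ennreal (t powr (p - 1)) * indicator {0<..} t
      * (if ennreal (2 * t) < ?M x then 1 else 0) \<partial>lborel) \<partial>\<mu>)
    = (\<integral>\<^sup>+t. (\<integral>\<^sup>+x. ennreal (t powr (p - 1)) * indicator {0<..} t
      * (if ennreal (2 * t) < ?M x then 1 else 0) \<partial>\<mu>) \<partial>lborel)"
    by (intro Fubini') measurable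
  also have "\<dots> \<le> (\<integral>\<^sup>+t. (\<integral>\<^sup>+x. ennreal c * (ennreal (t powr (p - 2)) * indicator {0<..} t
      * (g x * (if ennreal t < g x then 1 else 0))) \<partial>\<mu>) \<partial>lborel)"
  proof (rule nn_integral_mono)
    fix t :: real
    show "(\<integral>\<^sup>+x. ennreal (t powr (p - 1)) * indicator {0<..} t
        * (if ennreal (2 * t) < ?M x then 1 else 0) \<partial>\<mu>)
      \<le> (\<integral>\<^sup>+x. ennreal c * (ennreal (t powr (p - 2)) * indicator {0<..} t
        * (g x * (if ennreal t < g x then 1 else 0))) \<partial>\<mu>)"
    proof (cases "0 < t")
      case True
      have "(\<integral>\<^sup>+x. ennreal (t powr (p - 1)) * indicator {0<..} t
          * (if ennreal (2 * t) < ?M x then 1 else 0) \<partial>\<mu>)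
        = (\<integral>\<^sup>+x. ennreal (t powr (p - 1)) * indicator {x. ennreal (2 * t) < ?M x} x \<partial>\<mu>)"
        using True by (intro nn_integral_cong) (auto simp: indicator_def)
      also have "\<dots> = ennreal (t powr (p - 1)) * emeasure \<mu> {x. ennreal (2 * t) < ?M x}"
        by (rule nn_integral_cmult_indicator) measurable
      also have "\<dots> \<le> ennreal (t powr (p - 1)) *
          (ennreal (c / t) * (\<integral>\<^sup>+x. g x * indicator {y. ennreal t < g y} x \<partial>\<mu>))"
        by (intro mult_left_mono max_fun_superlevel[OF \<mu> I g True cI]) auto
      also have "\<dots> = ennreal (c * t powr (p - 2)) * (\<integral>\<^sup>+x. g x * indicator {y. ennreal t < g y} x \<partial>\<mu>)"
        using True c powr_add[of t "p - 2" 1]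
        by (simp add: mult.assoc[symmetric] ennreal_mult[symmetric] field_simps)
      also have "\<dots> = (\<integral>\<^sup>+x. ennreal (c * t powr (p - 2)) * (g x * indicator {y. ennreal t < g y} x) \<partial>\<mu>)"
        by (rule nn_integral_cmult[symmetric]) measurable
      also have "\<dots> = (\<integral>\<^sup>+x. ennreal c * (ennreal (t powr (p - 2)) * indicator {0<..} t
          * (g x * (if ennreal t < g x then 1 else 0))) \<partial>\<mu>)"
        using True c
        by (intro nn_integral_cong) (auto simp: ennreal_mult mult.assoc indicator_def)
      finally show ?thesis .
    qed simp
  qed
  also have "\<dots> = (\<integral>\<^sup>+x. (\<integral>\<^sup>+t. ennreal c * (ennreal (t powr (p - 2)) * indicator {0<..} t
      * (g x * (if ennreal t < g x then 1 else 0))) \<partial>lborel) \<partial>\<mu>)"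
    by (intro Fubini'[symmetric]) measurable
  also have "\<dots> = (\<integral>\<^sup>+x. ennreal c * (g x * (\<integral>\<^sup>+t. ennreal (t powr (p - 2)) * indicator {0<..} t
      * (if ennreal t < g x then 1 else 0) \<partial>lborel)) \<partial>\<mu>)"
    by (simp add: nn_integral_cmult[symmetric] ac_simps)
  also have "\<dots> \<le> (\<integral>\<^sup>+x. ennreal c * (ennreal (1 / (p - 1)) * ennreal_powr (g x) p) \<partial>\<mu>)"
    by (intro nn_integral_mono mult_left_mono ennreal_layer_cake_ge p) auto
  also have "\<dots> = (\<integral>\<^sup>+x. ennreal (c / (p - 1)) * ennreal_powr (g x) p \<partial>\<mu>)"
    using p c by (simp add: mult.assoc[symmetric] ennreal_mult[symmetric])
  also have "\<dots> = ennreal (c / (p - 1)) * (\<integral>\<^sup>+x. ennreal_powr (g x) p \<partial>\<mu>)"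
    by (rule nn_integral_cmult) measurable
  finally have "(\<integral>\<^sup>+x. ennreal_powr (?M x) p \<partial>\<mu>)
    \<le> ennreal (2 powr p * p) * (ennreal (c / (p - 1)) * (\<integral>\<^sup>+x. ennreal_powr (g x) p \<partial>\<mu>))"
    by (simp add: mult_left_mono)
  also have "\<dots> = ennreal (2 powr p * p * c / (p - 1)) * (\<integral>\<^sup>+x. ennreal_powr (g x) p \<partial>\<mu>)"
    using p c by (simp add: mult.assoc[symmetric] ennreal_mult[symmetric])
  finally show ?thesis .
qed

subsection \<open>Muckenhoupt's theorem\<close>

lemma content_ball_scale:
  fixes x y :: "'a::euclidean_space"
  assumes "0 \<le> r" "0 \<le> k"
  shows "measure lborel (ball x (k * r)) = k ^ DIM('a) * measure lborel (ball y r)"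
proof -
  have 1: "measure lborel (ball x (k * r)) = (k * r) ^ DIM('a) * measure lborel (ball (0::'a) 1)"
    using assms content_ball_conv_unit_ball[of "k * r" x] by simp
  have 2: "measure lborel (ball y r) = r ^ DIM('a) * measure lborel (ball (0::'a) 1)"
    using assms content_ball_conv_unit_ball[of r y] by simp
  show ?thesis unfolding 1 2 by (simp add: power_mult_distrib)
qed

lemma emeasure_lborel_ball: "emeasure lborel (ball x r) = ennreal (measure lborel (ball x r))"
  using emeasure_lborel_ball_finite[of x r] by (intro emeasure_eq_ennreal_measure) auto

definition dual_weight :: "real \<Rightarrow> ('a \<Rightarrow> real) \<Rightarrow> 'a \<Rightarrow> real" where
  "dual_weight p w x = w x powr (- 1 / (p - 1))"

text \<open>Balls replace cubes since the maximal functions run over balls. The real witnesses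
  record that both integrals are positive and finite, and the inequality is the usual product of
  averages cleared of denominators. Measurability and positivity everywhere amount to having fixed a
  representative of the weight.\<close>

definition ball_Ap :: "real \<Rightarrow> real \<Rightarrow> ('a::euclidean_space \<Rightarrow> real) \<Rightarrow> bool" where
  "ball_Ap p A w \<longleftrightarrow> w \<in> borel_measurable borel \<and> (\<forall>x. 0 < w x) \<and>
    (\<forall>x r. 0 < r \<longrightarrow> (\<exists>W S. 0 < W \<and> 0 < S \<and>
      (\<integral>\<^sup>+y\<in>ball x r. ennreal (w y) \<partial>lborel) = ennreal W \<and>
      (\<integral>\<^sup>+y\<in>ball x r. ennreal (dual_weight p w y) \<partial>lborel) = ennreal S \<and>
      W * S powr (p - 1) \<le> A * measure lborel (ball x r) powr p))"

lemma ball_ApE: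
  assumes "ball_Ap p A w" "0 < r"
  obtains W S where "0 < W" "0 < S"
    "(\<integral>\<^sup>+y\<in>ball x r. ennreal (w y) \<partial>lborel) = ennreal W"
    "(\<integral>\<^sup>+y\<in>ball x r. ennreal (dual_weight p w y) \<partial>lborel) = ennreal S"
    "W * S powr (p - 1) \<le> A * measure lborel (ball x r) powr p"
  using assms unfolding ball_Ap_def by blast

lemma dual_weight_measurable [measurable]:
  "w \<in> borel_measurable M \<Longrightarrow> dual_weight p w \<in> borel_measurable M"
  unfolding dual_weight_def[abs_def] by measurable

lemma dual_weight_pos: "0 < w x \<Longrightarrow> 0 < dual_weight p w x"
  by (simp add: dual_weight_def)

text \<open>Hoelder's inequality for \<open>w powr (1 / p)\<close> and
  \<open>dual_weight p w powr (1 / q)\<close>, whose product is identically 1, so that its integral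
  over \<open>B\<close> is \<open>V\<close>. It is obtained by integrating Young's inequality for
  the normalised factors.\<close>

lemma holder_weight_dual:
  fixes B :: "'a::euclidean_space set"
  assumes p: "1 < p" and [measurable]: "w \<in> borel_measurable borel" "B \<in> sets borel"
    and w: "\<And>x. 0 < w x" and WS: "0 < W" "0 < S"
    and W: "(\<integral>\<^sup>+y\<in>B. ennreal (w y) \<partial>lborel) = ennreal W"
    and S: "(\<integral>\<^sup>+y\<in>B. ennreal (dual_weight p w y) \<partial>lborel) = ennreal S"
    and V: "emeasure lborel B = ennreal V" "0 \<le> V"
  shows "V powr p \<le> W * S powr (p - 1)"
proof -
  define q where "q = p / (p - 1)"
  have q: "1 < q" "1 / p + 1 / q = 1" using p by (auto simp: q_def field_simps)
  define k where "k = 1 / (W powr (1 / p) * S powr (1 / q))"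
  have k: "0 < k" using WS by (simp add: k_def)
  \<comment> \<open>The constant \<open>k\<close> is the product of the factors normalised by
    \<open>W\<close> and \<open>S\<close>; the right-hand side integrates over \<open>B\<close> to
    \<open>1 / p + 1 / q = 1\<close>.\<close>
  have young: "k \<le> 1 / (p * W) * w y + 1 / (q * S) * dual_weight p w y" for y
  proof -
    let ?s = "dual_weight p w y"
    have s: "0 < ?s" by (simp add: dual_weight_pos w)
    have "w y powr (1 / p) * ?s powr (1 / q) = w y powr (1 / p - 1 / (p - 1) * (1 / q))"
      using w[of y] by (simp add: dual_weight_def powr_powr powr_add[symmetric])
    also have "1 / p - 1 / (p - 1) * (1 / q) = 0" using p by (simp add: q_def)
    finally have "w y powr (1 / p) * ?s powr (1 / q) = 1" using w[of y] by simp
    then have "k = (w y / W) powr (1 / p) * (?s / S) powr (1 / q)"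
      using w[of y] s WS by (simp add: k_def powr_divide)
    also have "\<dots> \<le> ((w y / W) powr (1 / p)) powr p / p + ((?s / S) powr (1 / q)) powr q / q"
      using p q by (intro Youngs_inequality) auto
    also have "\<dots> = 1 / (p * W) * w y + 1 / (q * S) * ?s"
      using p q w[of y] s WS by (simp add: powr_powr mult.commute)
    finally show ?thesis .
  qed
  have "ennreal (k * V) = (\<integral>\<^sup>+y\<in>B. ennreal k \<partial>lborel)"
    using V k by (subst nn_integral_cmult_indicator) (auto simp: ennreal_mult)
  also have "\<dots> \<le> (\<integral>\<^sup>+y. ennreal (1 / (p * W)) * (ennreal (w y) * indicator B y)
      + ennreal (1 / (q * S)) * (ennreal (dual_weight p w y) * indicator B y) \<partial>lborel)"
  proof (rule nn_integral_mono)
    fix y :: 'a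
    have "ennreal k \<le> ennreal (1 / (p * W)) * ennreal (w y) + ennreal (1 / (q * S)) * ennreal (dual_weight p w y)"
      using young[of y] p q WS w[of y] dual_weight_pos[of w y p]
      by (simp add: ennreal_mult[symmetric] ennreal_plus[symmetric] del: ennreal_plus)
    then show "ennreal k * indicator B y \<le> ennreal (1 / (p * W)) * (ennreal (w y) * indicator B y)
      + ennreal (1 / (q * S)) * (ennreal (dual_weight p w y) * indicator B y)"
      by (simp add: indicator_def)
  qed
  also have "\<dots> = ennreal (1 / (p * W)) * ennreal W + ennreal (1 / (q * S)) * ennreal S"
    by (subst nn_integral_add) (auto simp: nn_integral_cmult W S)
  also have "\<dots> = ennreal 1"
    using p q WS by (simp add: ennreal_mult[symmetric] ennreal_plus[symmetric] del: ennreal_plus)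
  finally have "k * V \<le> 1" by (simp add: ennreal_le_1)
  then have "V \<le> W powr (1 / p) * S powr (1 / q)"
    using WS by (simp add: k_def field_simps)
  then have "V powr p \<le> (W powr (1 / p) * S powr (1 / q)) powr p"
    using p V by (intro powr_mono2) auto
  also have "\<dots> = W * S powr (p - 1)"
    using p WS by (simp add: powr_mult powr_powr q_def)
  finally show ?thesis .
qed

text \<open>With primes for the fivefold ball, the \<open>A_p\<close> condition bounds
  \<open>W' * S' powr (p - 1)\<close> by \<open>c * V powr p\<close>, where \<open>V\<close> is the
  volume of the small ball, and Hoelder's inequality bounds this by
  \<open>c * W * S powr (p - 1)\<close>. Since \<open>W <= W'\<close> and \<open>S <= S'\<close>,
  cancelling one factor or the other gives the two doubling conditions.\<close>

lemma ball_Ap_doubling: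
  fixes w :: "'a::euclidean_space \<Rightarrow> real" and p :: real
  assumes p: "1 < p" and A: "0 < A" and w: "ball_Ap p A w"
  defines "c \<equiv> A * 5 powr (DIM('a) * p)"
  shows "doubling c (density lborel w)"
    and "doubling (c powr (1 / (p - 1))) (density lborel (dual_weight p w))"
proof -
  have [measurable]: "w \<in> borel_measurable borel" and wpos: "\<And>x. 0 < w x"
    using w by (auto simp: ball_Ap_def)
  have c: "0 < c" using A by (simp add: c_def)
  have ew: "emeasure (density lborel w) (ball x r) = (\<integral>\<^sup>+y\<in>ball x r. ennreal (w y) \<partial>lborel)"
    and es: "emeasure (density lborel (dual_weight p w)) (ball x r)
      = (\<integral>\<^sup>+y\<in>ball x r. ennreal (dual_weight p w y) \<partial>lborel)" for x r
    by (simp_all add: emeasure_density)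
  have main: "0 < emeasure (density lborel w) (ball x r) \<and> emeasure (density lborel w) (ball x r) < \<infinity> \<and>
      emeasure (density lborel w) (ball x (5 * r)) \<le> ennreal c * emeasure (density lborel w) (ball x r) \<and>
      0 < emeasure (density lborel (dual_weight p w)) (ball x r) \<and>
      emeasure (density lborel (dual_weight p w)) (ball x r) < \<infinity> \<and>
      emeasure (density lborel (dual_weight p w)) (ball x (5 * r))
        \<le> ennreal (c powr (1 / (p - 1))) * emeasure (density lborel (dual_weight p w)) (ball x r)"
    if r: "0 < r" for x r
  proof -
    obtain W S where WS: "0 < W" "0 < S"
      "(\<integral>\<^sup>+y\<in>ball x r. ennreal (w y) \<partial>lborel) = ennreal W"
      "(\<integral>\<^sup>+y\<in>ball x r. ennreal (dual_weight p w y) \<partial>lborel) = ennreal S"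
      by (rule ball_ApE[OF w r, of x])
    have "0 < 5 * r" using r by simp
    then obtain W' S' where WS': "0 < W'" "0 < S'"
      "(\<integral>\<^sup>+y\<in>ball x (5 * r). ennreal (w y) \<partial>lborel) = ennreal W'"
      "(\<integral>\<^sup>+y\<in>ball x (5 * r). ennreal (dual_weight p w y) \<partial>lborel) = ennreal S'"
      "W' * S' powr (p - 1) \<le> A * measure lborel (ball x (5 * r)) powr p"
      by (rule ball_ApE[OF w, of "5 * r" x])
    have sub: "ball x r \<subseteq> ball x (5 * r)" using r by (intro subset_ball) simp
    have "ennreal W \<le> ennreal W'" unfolding WS(3)[symmetric] WS'(3)[symmetric]
      using sub by (intro nn_integral_mono) (auto simp: indicator_def)
    then have WW: "W \<le> W'" using WS' by (simp add: ennreal_le_iff)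
    have "ennreal S \<le> ennreal S'" unfolding WS(4)[symmetric] WS'(4)[symmetric]
      using sub by (intro nn_integral_mono) (auto simp: indicator_def)
    then have SS: "S \<le> S'" using WS' by (simp add: ennreal_le_iff)
    have "measure lborel (ball x (5 * r)) powr p = 5 powr (DIM('a) * p) * measure lborel (ball x r) powr p"
      using r content_ball_scale[of r 5 x x] by (simp add: powr_mult powr_powr flip: powr_realpow)
    with WS'(5) have "W' * S' powr (p - 1) \<le> c * measure lborel (ball x r) powr p"
      by (simp add: c_def)
    also have "\<dots> \<le> c * (W * S powr (p - 1))"
      using c by (intro mult_left_mono holder_weight_dual[OF p _ _ wpos WS(1,2,3,4)])
          (auto simp: emeasure_lborel_ball)
    finally have le: "W' * S' powr (p - 1) \<le> c * (W * S powr (p - 1))" .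
    have "W' * S powr (p - 1) \<le> W' * S' powr (p - 1)"
      using SS WS WS' p by (intro mult_left_mono powr_mono2) auto
    with le have "W' * S powr (p - 1) \<le> c * W * S powr (p - 1)" by (simp add: mult.assoc)
    then have 1: "W' \<le> c * W" using WS by simp
    have "W * S' powr (p - 1) \<le> W' * S' powr (p - 1)"
      using WW by (intro mult_right_mono) auto
    with le have "W * S' powr (p - 1) \<le> W * (c * S powr (p - 1))" by (simp add: mult.left_commute)
    then have "S' powr (p - 1) \<le> c * S powr (p - 1)" using WS by simp
    then have "(S' powr (p - 1)) powr (1 / (p - 1)) \<le> (c * S powr (p - 1)) powr (1 / (p - 1))"
      using p by (intro powr_mono2) auto
    then have 2: "S' \<le> c powr (1 / (p - 1)) * S"
      using p c WS WS' by (simp add: powr_mult powr_powr)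
    show ?thesis
      unfolding ew es WS(3,4) WS'(3,4) using 1 2 WS c by (auto simp: ennreal_mult[symmetric])
  qed
  show "doubling c (density lborel w)" "doubling (c powr (1 / (p - 1))) (density lborel (dual_weight p w))"
    using main c by (auto simp: doubling_def)
qed

lemma sigma_finite_density_lborel:
  fixes w :: "'a::euclidean_space \<Rightarrow> real"
  assumes [measurable]: "w \<in> borel_measurable borel"
  shows "sigma_finite_measure (density lborel w)"
  by (subst sigma_finite_measure.sigma_finite_iff_density_finite[OF sigma_finite_lborel]) auto

lemma ennreal_mult_regroup:
  assumes "0 \<le> u" "u * v = s"
  shows "ennreal u * (a * ennreal v) = ennreal s * a"
proof -
  have "ennreal s = ennreal u * ennreal v" using assms by (simp flip: ennreal_mult')
  then show ?thesis by (simp only: mult_ac)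
qed

text \<open>On a ball of volume \<open>V\<close>, let \<open>T\<close> be the average of
  \<open>g / dual_weight\<close> with respect to the dual weight, so that the average of
  \<open>g\<close> is \<open>T * S / V\<close>. The \<open>A_p\<close> condition bounds
  \<open>(S / V) powr (p - 1)\<close> by \<open>A * V / W\<close>. As \<open>T <= N\<close> on the
  whole ball, \<open>V * T powr (p - 1)\<close> is at most the integral of
  \<open>N powr (p - 1)\<close>, which is the integral of \<open>N powr (p - 1) / w\<close> against
  \<open>w\<close>; dividing by \<open>W\<close> makes this a weighted average.\<close>

lemma Ap_average_bound:
  fixes w :: "'a::euclidean_space \<Rightarrow> real"
  assumes p: "1 < p" and A: "0 < A" and w: "ball_Ap p A w"
    and I: "\<And>i. i \<in> I \<Longrightarrow> 0 < snd i" and cI: "countable I"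
    and [measurable]: "g \<in> borel_measurable borel"
  defines "N \<equiv> max_fun (density lborel (dual_weight p w)) I (\<lambda>y. g y * ennreal (1 / dual_weight p w y))"
  shows "ennreal_powr (max_fun lborel I g x) (p - 1)
    \<le> ennreal A * max_fun (density lborel w) I (\<lambda>z. ennreal_powr (N z) (p - 1) * ennreal (1 / w z)) x"
    (is "_ \<le> ennreal A * ?X")
proof -
  have [measurable]: "w \<in> borel_measurable borel" and wpos: "\<And>x. 0 < w x"
    using w by (auto simp: ball_Ap_def)
  have [measurable]: "N \<in> borel_measurable borel" unfolding N_def by (rule max_fun_measurable[OF cI])
  have "max_fun lborel I g x \<le> ennreal_powr (ennreal A * ?X) (1 / (p - 1))"
  proof (rule max_fun_least)
    fix i assume i: "i \<in> I" "x \<in> ball (fst i) (snd i)"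
    define B where "B = ball (fst i) (snd i)"
    have [measurable]: "B \<in> sets borel" by (simp add: B_def)
    obtain W S where WS: "0 < W" "0 < S"
      "(\<integral>\<^sup>+y\<in>B. ennreal (w y) \<partial>lborel) = ennreal W"
      "(\<integral>\<^sup>+y\<in>B. ennreal (dual_weight p w y) \<partial>lborel) = ennreal S"
      "W * S powr (p - 1) \<le> A * measure lborel B powr p"
      unfolding B_def by (rule ball_ApE[OF w I[OF i(1)], of "fst i"])
    define V where "V = measure lborel B"
    have V: "0 < V" "emeasure lborel B = ennreal V"
      using I[OF i(1)] by (auto simp: V_def B_def content_ball_pos emeasure_lborel_ball)
    define J where "J = (\<integral>\<^sup>+y\<in>B. g y \<partial>lborel)"
    define T where "T = J * ennreal (1 / S)"
    have "T \<le> N z" if z: "z \<in> B" for z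
    proof -
      have "(\<integral>\<^sup>+y\<in>B. g y * ennreal (1 / dual_weight p w y) \<partial>density lborel (dual_weight p w))
        = (\<integral>\<^sup>+y. ennreal (dual_weight p w y) * (g y * ennreal (1 / dual_weight p w y) * indicator B y) \<partial>lborel)"
        by (rule nn_integral_density) measurable
      also have "\<dots> = J" unfolding J_def
      proof (rule nn_integral_cong)
        fix y
        have "ennreal (dual_weight p w y) * ennreal (1 / dual_weight p w y) = 1"
          using dual_weight_pos[of w y p] wpos[of y] by (simp add: ennreal_mult[symmetric])
        then show "ennreal (dual_weight p w y) * (g y * ennreal (1 / dual_weight p w y) * indicator B y)
          = g y * indicator B y"
          by (metis (no_types, lifting) mult.assoc mult.commute mult.right_neutral)
      qed
      finally have *: "(\<integral>\<^sup>+y\<in>B. g y * ennreal (1 / dual_weight p w y) \<partial>density lborel (dual_weight p w)) = J" .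
      have "emeasure (density lborel (dual_weight p w)) B = ennreal S"
        using WS by (simp add: emeasure_density)
      with * have "T = (\<integral>\<^sup>+y\<in>B. g y * ennreal (1 / dual_weight p w y) \<partial>density lborel (dual_weight p w))
          / emeasure (density lborel (dual_weight p w)) B"
        using WS by (simp add: T_def divide_ennreal_def inverse_ennreal inverse_eq_divide)
      also have "\<dots> \<le> N z"
        unfolding N_def B_def using i(1) z[unfolded B_def] by (rule max_fun_upper)
      finally show ?thesis .
    qed
    then have "ennreal_powr T (p - 1) * ennreal V \<le> (\<integral>\<^sup>+z\<in>B. ennreal_powr (N z) (p - 1) \<partial>lborel)"
      unfolding V(2)[symmetric] using p
      by (subst nn_integral_cmult_indicator[symmetric], measurable)
        (intro nn_integral_mono, auto simp: indicator_def intro!: ennreal_powr_mono)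
    also have "\<dots> = (\<integral>\<^sup>+z. ennreal (w z) * (ennreal_powr (N z) (p - 1) * ennreal (1 / w z) * indicator B z) \<partial>lborel)"
    proof (rule nn_integral_cong)
      fix z
      have "ennreal (w z) * ennreal (1 / w z) = 1"
        using wpos[of z] by (simp add: ennreal_mult[symmetric])
      then show "ennreal_powr (N z) (p - 1) * indicator B z
        = ennreal (w z) * (ennreal_powr (N z) (p - 1) * ennreal (1 / w z) * indicator B z)"
        by (metis (no_types, lifting) mult.assoc mult.commute mult.right_neutral)
    qed
    also have "\<dots> = (\<integral>\<^sup>+z\<in>B. ennreal_powr (N z) (p - 1) * ennreal (1 / w z) \<partial>density lborel w)"
      by (rule nn_integral_density[symmetric]) measurable
    finally have TV: "ennreal_powr T (p - 1) * ennreal V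
      \<le> (\<integral>\<^sup>+z\<in>B. ennreal_powr (N z) (p - 1) * ennreal (1 / w z) \<partial>density lborel w)" (is "_ \<le> ?Y") .
    have "S powr (p - 1) / V powr (p - 1) \<le> A * V / W"
    proof -
      have "V powr p = V powr (p - 1) * V"
        using V powr_add[of V "p - 1" 1] by simp
      then show ?thesis using WS V by (simp add: field_simps V_def)
    qed
    then have SV: "(S / V) powr (p - 1) \<le> A * (V * (1 / W))"
      using WS V by (simp add: powr_divide)
    have "J / emeasure lborel B = T * ennreal (S / V)"
      using WS V by (simp add: T_def mult.assoc ennreal_mult[symmetric] divide_ennreal_def inverse_ennreal inverse_eq_divide)
    then have "ennreal_powr (J / emeasure lborel B) (p - 1) = ennreal_powr T (p - 1) * ennreal ((S / V) powr (p - 1))"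
      using p WS V by (simp add: ennreal_powr_mult)
    also have "\<dots> \<le> ennreal_powr T (p - 1) * ennreal (A * (V * (1 / W)))"
      using SV by (intro mult_left_mono ennreal_leI) auto
    also have "\<dots> = ennreal A * ((ennreal_powr T (p - 1) * ennreal V) * ennreal (1 / W))"
    proof -
      have "ennreal (A * (V * (1 / W))) = ennreal A * (ennreal V * ennreal (1 / W))"
        using A V WS by (subst ennreal_mult[symmetric], simp, simp, subst ennreal_mult[symmetric]) auto
      then show ?thesis by (simp only: mult_ac)
    qed
    also have "\<dots> \<le> ennreal A * (?Y * ennreal (1 / W))"
      using TV by (intro mult_left_mono mult_right_mono) auto
    also have "?Y * ennreal (1 / W) = ?Y / emeasure (density lborel w) B"
      using WS by (simp add: emeasure_density divide_ennreal_def inverse_ennreal inverse_eq_divide)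
    also have "\<dots> \<le> ?X"
      unfolding B_def using i by (rule max_fun_upper)
    finally have "ennreal_powr (J / emeasure lborel B) (p - 1) \<le> ennreal A * ?X"
      by (simp add: mult_left_mono)
    then show "(\<integral>\<^sup>+y\<in>ball (fst i) (snd i). g y \<partial>lborel) / emeasure lborel (ball (fst i) (snd i))
      \<le> ennreal_powr (ennreal A * ?X) (1 / (p - 1))"
      using p unfolding J_def B_def by (subst ennreal_powr_le_iff[symmetric]) auto
  qed
  then show ?thesis using p by (subst ennreal_powr_le_iff) auto
qed

text \<open>The first factor comes from raising the pointwise bound to the power \<open>q\<close>.
  The other two are strong type constants: for the measure \<open>w\<close> with exponent
  \<open>q\<close> and doubling constant \<open>c\<close>, and for the dual weight with exponent
  \<open>p\<close> and doubling constant \<open>c powr (1 / (p - 1))\<close>.\<close>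

definition muckenhoupt_const :: "nat \<Rightarrow> real \<Rightarrow> real \<Rightarrow> real" where
  "muckenhoupt_const n p A = (let c = A * 5 powr (n * p); q = p / (p - 1) in
     A powr q * (2 powr q * q * c / (q - 1)) * (2 powr p * p * c powr (1 / (p - 1)) / (p - 1)))"

text \<open>The conjugate exponent satisfies \<open>(p - 1) * q = p\<close>, so the
  \<open>q\<close>-th power of the pointwise bound controls the \<open>p\<close>-th power of the
  maximal function. The two maximal operators are then removed one after the other, each in its own
  measure.\<close>

theorem muckenhoupt:
  fixes w :: "'a::euclidean_space \<Rightarrow> real"
  assumes p: "1 < p" and A: "0 < A" and w: "ball_Ap p A w"
    and I: "\<And>i. i \<in> I \<Longrightarrow> 0 < snd i" and cI: "countable I"
    and [measurable]: "g \<in> borel_measurable borel"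
  shows "(\<integral>\<^sup>+x. ennreal_powr (max_fun lborel I g x) p * ennreal (w x) \<partial>lborel)
    \<le> ennreal (muckenhoupt_const DIM('a) p A) * (\<integral>\<^sup>+x. ennreal_powr (g x) p * ennreal (w x) \<partial>lborel)"
proof -
  have [measurable]: "w \<in> borel_measurable borel" and wpos: "\<And>x. 0 < w x"
    using w by (auto simp: ball_Ap_def)
  let ?s = "dual_weight p w"
  have spos: "0 < ?s x" for x by (simp add: dual_weight_pos wpos)
  define c where "c = A * 5 powr (DIM('a) * p)"
  define q where "q = p / (p - 1)"
  have c: "0 < c" and q: "1 < q" using A p by (auto simp: c_def q_def)
  define C1 where "C1 = 2 powr q * q * c / (q - 1)"
  define C2 where "C2 = 2 powr p * p * c powr (1 / (p - 1)) / (p - 1)"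
  have C: "0 \<le> C1" "0 \<le> C2" using c q p by (auto simp: C1_def C2_def)
  note doubling = ball_Ap_doubling[OF p A w, folded c_def]
  define h where "h y = g y * ennreal (1 / ?s y)" for y
  have [measurable]: "h \<in> borel_measurable borel" unfolding h_def by measurable
  define N where "N = max_fun (density lborel ?s) I h"
  have [measurable]: "N \<in> borel_measurable borel" unfolding N_def by (rule max_fun_measurable[OF cI])
  define k where "k z = ennreal_powr (N z) (p - 1) * ennreal (1 / w z)" for z
  have [measurable]: "k \<in> borel_measurable borel" unfolding k_def by measurable
  define X where "X = max_fun (density lborel w) I k"
  have [measurable]: "X \<in> borel_measurable borel" unfolding X_def by (rule max_fun_measurable[OF cI])
  have pt: "ennreal_powr (max_fun lborel I g x) p \<le> ennreal (A powr q) * ennreal_powr (X x) q" for x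
  proof -
    have "ennreal_powr (max_fun lborel I g x) (p - 1) \<le> ennreal A * X x"
      using Ap_average_bound[OF p A w I cI, of g x]
      unfolding X_def k_def N_def h_def by simp
    then have "ennreal_powr (ennreal_powr (max_fun lborel I g x) (p - 1)) q \<le> ennreal_powr (ennreal A * X x) q"
      using q by (intro ennreal_powr_mono) auto
    then show ?thesis using p q A by (simp add: ennreal_powr_powr ennreal_powr_mult q_def)
  qed
  have "(\<integral>\<^sup>+x. ennreal_powr (max_fun lborel I g x) p * ennreal (w x) \<partial>lborel)
    \<le> (\<integral>\<^sup>+x. ennreal (A powr q) * (ennreal (w x) * ennreal_powr (X x) q) \<partial>lborel)"
    using mult_right_mono[OF pt] by (intro nn_integral_mono) (auto simp: ac_simps)
  also have "\<dots> = ennreal (A powr q) * (\<integral>\<^sup>+x. ennreal_powr (X x) q \<partial>density lborel w)"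
    by (simp add: nn_integral_cmult nn_integral_density)
  also have "\<dots> \<le> ennreal (A powr q) * (ennreal C1 * (\<integral>\<^sup>+x. ennreal_powr (k x) q \<partial>density lborel w))"
    unfolding X_def C1_def
    by (intro mult_left_mono max_fun_strong_type[OF doubling(1) I cI _ _ q] sigma_finite_density_lborel) auto
  also have "(\<integral>\<^sup>+x. ennreal_powr (k x) q \<partial>density lborel w)
      = (\<integral>\<^sup>+x. ennreal (w x) * ennreal_powr (k x) q \<partial>lborel)"
    by (simp add: nn_integral_density)
  \<comment> \<open>The change from \<open>w\<close> to the dual weight:
    \<open>w * (N powr (p - 1) / w) powr q = w powr (1 - q) * N powr p\<close>, and
    \<open>1 - q = - 1 / (p - 1)\<close>.\<close>
  also have "\<dots> = (\<integral>\<^sup>+x. ennreal (?s x) * ennreal_powr (N x) p \<partial>lborel)"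
  proof (rule nn_integral_cong)
    fix x
    have "ennreal_powr (k x) q = ennreal_powr (N x) p * ennreal (w x powr (- q))"
      using p q wpos[of x] less_imp_le[OF wpos[of x]]
      by (simp add: k_def ennreal_powr_mult ennreal_powr_powr q_def powr_divide powr_minus_divide)
    moreover have "w x * w x powr (- q) = ?s x"
    proof -
      have "1 - q = - 1 / (p - 1)" using p by (simp add: q_def field_simps)
      then show ?thesis using wpos[of x] powr_add[of "w x" 1 "- q"] by (simp add: dual_weight_def)
    qed
    ultimately show "ennreal (w x) * ennreal_powr (k x) q = ennreal (?s x) * ennreal_powr (N x) p"
      using ennreal_mult_regroup[OF less_imp_le[OF wpos]] by metis
  qed
  also have "\<dots> = (\<integral>\<^sup>+x. ennreal_powr (N x) p \<partial>density lborel ?s)"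
    by (simp add: nn_integral_density)
  also have "\<dots> \<le> ennreal C2 * (\<integral>\<^sup>+x. ennreal_powr (h x) p \<partial>density lborel ?s)"
    unfolding N_def C2_def
    by (intro max_fun_strong_type[OF doubling(2) I cI _ _ p] sigma_finite_density_lborel) auto
  also have "(\<integral>\<^sup>+x. ennreal_powr (h x) p \<partial>density lborel ?s)
      = (\<integral>\<^sup>+x. ennreal (?s x) * ennreal_powr (h x) p \<partial>lborel)"
    by (simp add: nn_integral_density)
  \<comment> \<open>The change back: the power \<open>1 - p\<close> of the dual weight is
    \<open>w\<close>.\<close>
  also have "\<dots> = (\<integral>\<^sup>+x. ennreal_powr (g x) p * ennreal (w x) \<partial>lborel)"
  proof (rule nn_integral_cong)
    fix x
    have "ennreal_powr (h x) p = ennreal_powr (g x) p * ennreal (?s x powr (- p))"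
      using p spos[of x] less_imp_le[OF spos[of x]]
      by (simp add: h_def ennreal_powr_mult ennreal_powr_powr powr_divide powr_minus_divide)
    moreover have "?s x * ?s x powr (- p) = w x"
    proof -
      have "?s x * ?s x powr (- p) = ?s x powr (1 - p)"
        using spos[of x] powr_add[of "?s x" 1 "- p"] by simp
      also have "\<dots> = w x powr (- 1 / (p - 1) * (1 - p))" by (simp only: dual_weight_def powr_powr)
      also have "- 1 / (p - 1) * (1 - p) = 1" using p by (simp add: divide_simps)
      finally show ?thesis using wpos[of x] by simp
    qed
    ultimately show "ennreal (?s x) * ennreal_powr (h x) p = ennreal_powr (g x) p * ennreal (w x)"
      using ennreal_mult_regroup[OF less_imp_le[OF spos]] by (metis mult.commute)
  qed
  finally have "(\<integral>\<^sup>+x. ennreal_powr (max_fun lborel I g x) p * ennreal (w x) \<partial>lborel)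
    \<le> ennreal (A powr q) * (ennreal C1 * (ennreal C2 * (\<integral>\<^sup>+x. ennreal_powr (g x) p * ennreal (w x) \<partial>lborel)))"
    by (simp add: mult_left_mono)
  also have "\<dots> = ennreal (A powr q * C1 * C2) * (\<integral>\<^sup>+x. ennreal_powr (g x) p * ennreal (w x) \<partial>lborel)"
    using C by (simp add: ennreal_mult mult.assoc)
  also have "A powr q * C1 * C2 = muckenhoupt_const DIM('a) p A"
    by (simp add: muckenhoupt_const_def C1_def C2_def c_def q_def Let_def)
  finally show ?thesis .
qed

subsection \<open>Directional maximal functions on pairs\<close>

lemma nn_integral_lborel_affine:
  fixes f :: "'a::euclidean_space \<Rightarrow> ennreal"
  assumes [measurable]: "f \<in> borel_measurable borel" and c: "c \<noteq> 0"
  shows "(\<integral>\<^sup>+x. f x \<partial>lborel) = ennreal (\<bar>c\<bar> ^ DIM('a)) * (\<integral>\<^sup>+x. f (t + c *\<^sub>R x) \<partial>lborel)"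
  by (subst lborel_affine[OF c, of t])
    (simp add: nn_integral_density nn_integral_distr nn_integral_cmult)

lemma nn_integral_lborel_translate:
  fixes f :: "'a::euclidean_space \<Rightarrow> ennreal"
  assumes [measurable]: "f \<in> borel_measurable borel"
  shows "(\<integral>\<^sup>+x. f (t + x) \<partial>lborel) = (\<integral>\<^sup>+x. f x \<partial>lborel)"
  using nn_integral_lborel_affine[of f 1 t] by simp

lemma nn_integral_lborel_uminus:
  fixes f :: "'a::euclidean_space \<Rightarrow> ennreal"
  assumes [measurable]: "f \<in> borel_measurable borel"
  shows "(\<integral>\<^sup>+x. f (- x) \<partial>lborel) = (\<integral>\<^sup>+x. f x \<partial>lborel)"
  using nn_integral_lborel_affine[of f "-1" 0] by simp

text \<open>For a frozen second variable \<open>y\<close> the weight of the double integral is a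
  translate of \<open>w\<close>; that \<open>A\<close> stays the same makes the bounds uniform in
  \<open>y\<close>.\<close>

lemma ball_Ap_translate:
  fixes w :: "'a::euclidean_space \<Rightarrow> real"
  assumes "ball_Ap p A w"
  shows "ball_Ap p A (\<lambda>x. w (x - t))"
proof -
  have [measurable]: "w \<in> borel_measurable borel" using assms by (auto simp: ball_Ap_def)
  have *: "(\<integral>\<^sup>+y\<in>ball x r. g (y - t) \<partial>lborel) = (\<integral>\<^sup>+y\<in>ball (x - t) r. g y \<partial>lborel)"
    if [measurable]: "g \<in> borel_measurable borel" for g :: "'a \<Rightarrow> ennreal" and x r
    by (subst nn_integral_lborel_translate[symmetric, where t = t])
      (auto intro!: nn_integral_cong simp: indicator_def dist_norm algebra_simps)
  have d: "dual_weight p (\<lambda>x. w (x - t)) y = dual_weight p w (y - t)" for y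
    by (simp add: dual_weight_def)
  have m: "measure lborel (ball x r) = measure lborel (ball (x - t) r)" for x :: 'a and r
    by (cases "0 \<le> r") (use content_ball_scale[of r 1 x "x - t"] in \<open>simp_all add: ball_empty\<close>)
  show ?thesis
    unfolding ball_Ap_def
  proof (intro conjI allI impI)
    show "(\<lambda>x. w (x - t)) \<in> borel_measurable borel" by measurable
    show "0 < w (x - t)" for x using assms by (auto simp: ball_Ap_def)
    fix x :: 'a and r :: real assume "0 < r"
    from ball_ApE[OF assms this, of "x - t"] obtain W S where WS: "0 < W" "0 < S"
      "(\<integral>\<^sup>+y\<in>ball (x - t) r. ennreal (w y) \<partial>lborel) = ennreal W"
      "(\<integral>\<^sup>+y\<in>ball (x - t) r. ennreal (dual_weight p w y) \<partial>lborel) = ennreal S"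
      "W * S powr (p - 1) \<le> A * measure lborel (ball (x - t) r) powr p" .
    show "\<exists>W S. 0 < W \<and> 0 < S \<and> (\<integral>\<^sup>+y\<in>ball x r. ennreal (w (y - t)) \<partial>lborel) = ennreal W \<and>
      (\<integral>\<^sup>+y\<in>ball x r. ennreal (dual_weight p (\<lambda>x. w (x - t)) y) \<partial>lborel) = ennreal S \<and>
      W * S powr (p - 1) \<le> A * measure lborel (ball x r) powr p"
      using WS *[of "\<lambda>y. ennreal (w y)" x r] *[of "\<lambda>y. ennreal (dual_weight p w y)" x r]
      by (intro exI[of _ W] exI[of _ S]) (simp add: d m[of x])
  qed
qed

text \<open>Terms with exchanged arguments meet the reflected weight once the variables are
  renamed.\<close>

lemma ball_Ap_reflect:
  fixes w :: "'a::euclidean_space \<Rightarrow> real"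
  assumes "ball_Ap p A w"
  shows "ball_Ap p A (\<lambda>x. w (- x))"
proof -
  have [measurable]: "w \<in> borel_measurable borel" using assms by (auto simp: ball_Ap_def)
  have *: "(\<integral>\<^sup>+y\<in>ball x r. g (- y) \<partial>lborel) = (\<integral>\<^sup>+y\<in>ball (- x) r. g y \<partial>lborel)"
    if [measurable]: "g \<in> borel_measurable borel" for g :: "'a \<Rightarrow> ennreal" and x r
    by (subst nn_integral_lborel_uminus[symmetric])
      (auto intro!: nn_integral_cong simp: indicator_def dist_norm norm_minus_commute)
  have d: "dual_weight p (\<lambda>x. w (- x)) y = dual_weight p w (- y)" for y
    by (simp add: dual_weight_def)
  have m: "measure lborel (ball x r) = measure lborel (ball (- x) r)" for x :: 'a and r
    by (cases "0 \<le> r") (use content_ball_scale[of r 1 x "- x"] in \<open>simp_all add: ball_empty\<close>)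
  show ?thesis
    unfolding ball_Ap_def
  proof (intro conjI allI impI)
    show "(\<lambda>x. w (- x)) \<in> borel_measurable borel" by measurable
    show "0 < w (- x)" for x using assms by (auto simp: ball_Ap_def)
    fix x :: 'a and r :: real assume "0 < r"
    from ball_ApE[OF assms this, of "- x"] obtain W S where WS: "0 < W" "0 < S"
      "(\<integral>\<^sup>+y\<in>ball (- x) r. ennreal (w y) \<partial>lborel) = ennreal W"
      "(\<integral>\<^sup>+y\<in>ball (- x) r. ennreal (dual_weight p w y) \<partial>lborel) = ennreal S"
      "W * S powr (p - 1) \<le> A * measure lborel (ball (- x) r) powr p" .
    show "\<exists>W S. 0 < W \<and> 0 < S \<and> (\<integral>\<^sup>+y\<in>ball x r. ennreal (w (- y)) \<partial>lborel) = ennreal W \<and>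
      (\<integral>\<^sup>+y\<in>ball x r. ennreal (dual_weight p (\<lambda>x. w (- x)) y) \<partial>lborel) = ennreal S \<and>
      W * S powr (p - 1) \<le> A * measure lborel (ball x r) powr p"
      using WS *[of "\<lambda>y. ennreal (w y)" x r] *[of "\<lambda>y. ennreal (dual_weight p w y)" x r]
      by (intro exI[of _ W] exI[of _ S]) (simp add: d m[of x])
  qed
qed

lemma doubling_lborel: "doubling (5 ^ DIM('a)) (lborel :: 'a::euclidean_space measure)"
  unfolding doubling_def
proof (intro conjI allI impI)
  fix x :: 'a and r :: real assume r: "0 < r"
  show "0 < emeasure lborel (ball x r)" "emeasure lborel (ball x r) < \<infinity>"
    using r by (simp_all add: emeasure_lborel_ball content_ball_pos)
  show "emeasure lborel (ball x (5 * r)) \<le> ennreal (5 ^ DIM('a)) * emeasure lborel (ball x r)"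
    using r content_ball_scale[of r 5 x x] unfolding emeasure_lborel_ball
    by (subst ennreal_mult[symmetric]) auto
qed auto

definition max_fst :: "('a::euclidean_space \<times> real) set \<Rightarrow> ('a \<Rightarrow> 'a \<Rightarrow> ennreal) \<Rightarrow> 'a \<Rightarrow> 'a \<Rightarrow> ennreal"
  where "max_fst I F x y = max_fun lborel I (\<lambda>z. F z y) x"

text \<open>The points \<open>(z, z + (y - x))\<close> form the parallel to the diagonal through
  \<open>(x, y)\<close>, parametrised by its first coordinate.\<close>

definition max_diag :: "('a::euclidean_space \<times> real) set \<Rightarrow> ('a \<Rightarrow> 'a \<Rightarrow> ennreal) \<Rightarrow> 'a \<Rightarrow> 'a \<Rightarrow> ennreal"
  where "max_diag I F x y = max_fun lborel I (\<lambda>z. F z (z + (y - x))) x"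

text \<open>Joint measurability is required because this function is integrated in both variables
  and is also the argument of \<open>max_diag\<close>. Each ball contributes a parameter integral
  times an indicator, and there are countably many of them.\<close>

lemma max_fst_measurable:
  assumes "countable I" and [measurable]: "case_prod F \<in> borel_measurable (borel \<Otimes>\<^sub>M borel)"
  shows "case_prod (max_fst I F) \<in> borel_measurable (borel \<Otimes>\<^sub>M borel)"
proof -
  have "(\<lambda>u. SUP i\<in>I. indicator (ball (fst i) (snd i)) (fst u) *
      ((\<integral>\<^sup>+z\<in>ball (fst i) (snd i). F z (snd u) \<partial>lborel) / emeasure lborel (ball (fst i) (snd i))))
      \<in> borel_measurable (borel \<Otimes>\<^sub>M borel)"
    using assms(1)
  proof (rule borel_measurable_SUP)
    fix i
    have [measurable]: "ball (fst i) (snd i) \<in> sets borel" for i :: "'a \<times> real" by simp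
    show "(\<lambda>u. indicator (ball (fst i) (snd i)) (fst u) *
      ((\<integral>\<^sup>+z\<in>ball (fst i) (snd i). F z (snd u) \<partial>lborel) / emeasure lborel (ball (fst i) (snd i))))
      \<in> borel_measurable (borel \<Otimes>\<^sub>M borel)" by measurable
  qed
  then show ?thesis by (simp add: max_fst_def max_fun_def case_prod_unfold)
qed

lemma max_diag_measurable:
  assumes "countable I" and [measurable]: "case_prod F \<in> borel_measurable (borel \<Otimes>\<^sub>M borel)"
  shows "case_prod (max_diag I F) \<in> borel_measurable (borel \<Otimes>\<^sub>M borel)"
proof -
  have "(\<lambda>u. SUP i\<in>I. indicator (ball (fst i) (snd i)) (fst u) *
      ((\<integral>\<^sup>+z\<in>ball (fst i) (snd i). F z (z + (snd u - fst u)) \<partial>lborel) / emeasure lborel (ball (fst i) (snd i))))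
      \<in> borel_measurable (borel \<Otimes>\<^sub>M borel)"
    using assms(1)
  proof (rule borel_measurable_SUP)
    fix i
    have [measurable]: "ball (fst i) (snd i) \<in> sets borel" for i :: "'a \<times> real" by simp
    show "(\<lambda>u. indicator (ball (fst i) (snd i)) (fst u) *
      ((\<integral>\<^sup>+z\<in>ball (fst i) (snd i). F z (z + (snd u - fst u)) \<partial>lborel) / emeasure lborel (ball (fst i) (snd i))))
      \<in> borel_measurable (borel \<Otimes>\<^sub>M borel)" by measurable
  qed
  then show ?thesis by (simp add: max_diag_def max_fun_def case_prod_unfold)
qed

text \<open>Tonelli makes \<open>x\<close> the inner variable; for each \<open>y\<close>
  Muckenhoupt's theorem applies to the translated weight with the same constant.\<close>

lemma max_fst_strong_type:
  fixes F :: "'a::euclidean_space \<Rightarrow> 'a \<Rightarrow> ennreal"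
  assumes p: "1 < p" and A: "0 < A" and w: "ball_Ap p A w"
    and I: "\<And>i. i \<in> I \<Longrightarrow> 0 < snd i" and cI: "countable I"
    and F[measurable]: "case_prod F \<in> borel_measurable (borel \<Otimes>\<^sub>M borel)"
  shows "(\<integral>\<^sup>+x. (\<integral>\<^sup>+y. ennreal_powr (max_fst I F x y) p * ennreal (w (x - y)) \<partial>lborel) \<partial>lborel)
    \<le> ennreal (muckenhoupt_const DIM('a) p A) *
      (\<integral>\<^sup>+x. (\<integral>\<^sup>+y. ennreal_powr (F x y) p * ennreal (w (x - y)) \<partial>lborel) \<partial>lborel)"
proof -
  have [measurable]: "w \<in> borel_measurable borel" using w by (auto simp: ball_Ap_def)
  note max_fst_measurable[OF cI F, measurable]
  have "(\<integral>\<^sup>+x. (\<integral>\<^sup>+y. ennreal_powr (max_fst I F x y) p * ennreal (w (x - y)) \<partial>lborel) \<partial>lborel)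
    = (\<integral>\<^sup>+y. (\<integral>\<^sup>+x. ennreal_powr (max_fst I F x y) p * ennreal (w (x - y)) \<partial>lborel) \<partial>lborel)"
    by (rule lborel_pair.Fubini'[symmetric]) measurable
  also have "\<dots> \<le> (\<integral>\<^sup>+y. ennreal (muckenhoupt_const DIM('a) p A) *
      (\<integral>\<^sup>+x. ennreal_powr (F x y) p * ennreal (w (x - y)) \<partial>lborel) \<partial>lborel)"
  proof (rule nn_integral_mono)
    fix y :: 'a
    have "(\<lambda>x. F x y) \<in> borel_measurable borel" by measurable
    from muckenhoupt[OF p A ball_Ap_translate[OF w, of y] I cI this]
    show "(\<integral>\<^sup>+x. ennreal_powr (max_fst I F x y) p * ennreal (w (x - y)) \<partial>lborel)
      \<le> ennreal (muckenhoupt_const DIM('a) p A) * (\<integral>\<^sup>+x. ennreal_powr (F x y) p * ennreal (w (x - y)) \<partial>lborel)"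
      unfolding max_fst_def .
  qed
  also have "\<dots> = ennreal (muckenhoupt_const DIM('a) p A) *
      (\<integral>\<^sup>+y. (\<integral>\<^sup>+x. ennreal_powr (F x y) p * ennreal (w (x - y)) \<partial>lborel) \<partial>lborel)"
    by (rule nn_integral_cmult) measurable
  also have "(\<integral>\<^sup>+y. (\<integral>\<^sup>+x. ennreal_powr (F x y) p * ennreal (w (x - y)) \<partial>lborel) \<partial>lborel)
    = (\<integral>\<^sup>+x. (\<integral>\<^sup>+y. ennreal_powr (F x y) p * ennreal (w (x - y)) \<partial>lborel) \<partial>lborel)"
    by (rule lborel_pair.Fubini') measurable
  finally show ?thesis .
qed

text \<open>After \<open>y = x + h\<close> the weight depends on the outer variable alone.\<close>

lemma nn_integral_diagonal_shift:
  fixes H :: "'a::euclidean_space \<Rightarrow> 'a \<Rightarrow> ennreal"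
  assumes [measurable]: "case_prod H \<in> borel_measurable (borel \<Otimes>\<^sub>M borel)" "w \<in> borel_measurable borel"
  shows "(\<integral>\<^sup>+x. (\<integral>\<^sup>+y. H x y * ennreal (w (x - y)) \<partial>lborel) \<partial>lborel)
    = (\<integral>\<^sup>+h. (\<integral>\<^sup>+x. H x (x + h) \<partial>lborel) * ennreal (w (- h)) \<partial>lborel)"
proof -
  have "(\<integral>\<^sup>+x. (\<integral>\<^sup>+y. H x y * ennreal (w (x - y)) \<partial>lborel) \<partial>lborel)
    = (\<integral>\<^sup>+x. (\<integral>\<^sup>+h. H x (x + h) * ennreal (w (x - (x + h))) \<partial>lborel) \<partial>lborel)"
    by (intro nn_integral_cong nn_integral_lborel_translate[symmetric]) measurable
  also have "\<dots> = (\<integral>\<^sup>+h. (\<integral>\<^sup>+x. H x (x + h) * ennreal (w (x - (x + h))) \<partial>lborel) \<partial>lborel)"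
    by (rule lborel_pair.Fubini'[symmetric]) measurable
  also have "\<dots> = (\<integral>\<^sup>+h. (\<integral>\<^sup>+x. H x (x + h) \<partial>lborel) * ennreal (w (- h)) \<partial>lborel)"
    by (intro nn_integral_cong) (simp add: nn_integral_multc)
  finally show ?thesis .
qed

text \<open>For fixed \<open>h\<close>, \<open>max_diag I F x (x + h)\<close> is the ordinary
  maximal function of \<open>\<lambda>x. F x (x + h)\<close> and the weight is a constant factor, so
  the bound is that for Lebesgue measure with doubling constant \<open>5 ^ DIM('a)\<close>.\<close>

lemma max_diag_strong_type:
  fixes F :: "'a::euclidean_space \<Rightarrow> 'a \<Rightarrow> ennreal"
  assumes p: "1 < p" and [measurable]: "w \<in> borel_measurable borel"
    and I: "\<And>i. i \<in> I \<Longrightarrow> 0 < snd i" and cI: "countable I"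
    and F[measurable]: "case_prod F \<in> borel_measurable (borel \<Otimes>\<^sub>M borel)"
  shows "(\<integral>\<^sup>+x. (\<integral>\<^sup>+y. ennreal_powr (max_diag I F x y) p * ennreal (w (x - y)) \<partial>lborel) \<partial>lborel)
    \<le> ennreal (2 powr p * p * 5 ^ DIM('a) / (p - 1)) *
      (\<integral>\<^sup>+x. (\<integral>\<^sup>+y. ennreal_powr (F x y) p * ennreal (w (x - y)) \<partial>lborel) \<partial>lborel)"
    (is "_ \<le> ?C * _")
proof -
  note max_diag_measurable[OF cI F, measurable]
  have "(\<integral>\<^sup>+x. (\<integral>\<^sup>+y. ennreal_powr (max_diag I F x y) p * ennreal (w (x - y)) \<partial>lborel) \<partial>lborel)
    = (\<integral>\<^sup>+h. (\<integral>\<^sup>+x. ennreal_powr (max_diag I F x (x + h)) p \<partial>lborel) * ennreal (w (- h)) \<partial>lborel)"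
    by (rule nn_integral_diagonal_shift) measurable
  also have "\<dots> \<le> (\<integral>\<^sup>+h. ?C * ((\<integral>\<^sup>+x. ennreal_powr (F x (x + h)) p \<partial>lborel) * ennreal (w (- h))) \<partial>lborel)"
  proof (rule nn_integral_mono)
    fix h :: 'a
    have [measurable]: "(\<lambda>x. F x (x + h)) \<in> borel_measurable borel" by measurable
    have "(\<integral>\<^sup>+x. ennreal_powr (max_diag I F x (x + h)) p \<partial>lborel) \<le> ?C * (\<integral>\<^sup>+x. ennreal_powr (F x (x + h)) p \<partial>lborel)"
      using max_fun_strong_type[OF doubling_lborel I cI sigma_finite_lborel, of "\<lambda>x. F x (x + h)" p] p
      by (simp add: max_diag_def)
    from mult_right_mono[OF this, of "ennreal (w (- h))"]
    show "(\<integral>\<^sup>+x. ennreal_powr (max_diag I F x (x + h)) p \<partial>lborel) * ennreal (w (- h))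
      \<le> ?C * ((\<integral>\<^sup>+x. ennreal_powr (F x (x + h)) p \<partial>lborel) * ennreal (w (- h)))"
      by (simp add: mult.assoc)
  qed
  also have "\<dots> = ?C * (\<integral>\<^sup>+h. (\<integral>\<^sup>+x. ennreal_powr (F x (x + h)) p \<partial>lborel) * ennreal (w (- h)) \<partial>lborel)"
    by (rule nn_integral_cmult) measurable
  also have "(\<integral>\<^sup>+h. (\<integral>\<^sup>+x. ennreal_powr (F x (x + h)) p \<partial>lborel) * ennreal (w (- h)) \<partial>lborel)
    = (\<integral>\<^sup>+x. (\<integral>\<^sup>+y. ennreal_powr (F x y) p * ennreal (w (x - y)) \<partial>lborel) \<partial>lborel)"
    by (rule nn_integral_diagonal_shift[symmetric]) measurable
  finally show ?thesis .
qed

subsection \<open>Averages over balls and difference quotients\<close>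

text \<open>A countable substitute for the family of all balls; enlarging a ball to a member costs a
  factor of at most \<open>2 ^ DIM('a)\<close> in volume.\<close>

definition ball_net :: "('a::euclidean_space \<times> real) set \<Rightarrow> bool" where
  "ball_net I \<longleftrightarrow> countable I \<and> (\<forall>i\<in>I. 0 < snd i) \<and>
    (\<forall>x r. 0 < r \<longrightarrow> (\<exists>i\<in>I. ball x r \<subseteq> ball (fst i) (snd i) \<and> snd i \<le> 2 * r))"

lemma ball_net_exists: "\<exists>I :: ('a::euclidean_space \<times> real) set. ball_net I"
proof -
  obtain D :: "'a set" where D: "countable D" "\<And>X. open X \<Longrightarrow> X \<noteq> {} \<Longrightarrow> \<exists>d\<in>D. d \<in> X"
    using countable_dense_setE by blast
  have "ball_net (D \<times> (\<rat> \<inter> {0<..}))"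
    unfolding ball_net_def
  proof (intro conjI allI impI ballI)
    show "countable (D \<times> (\<rat> \<inter> {0<..} :: real set))"
      using D(1) countable_rat by (intro countable_SIGMA) auto
    show "0 < snd i" if "i \<in> D \<times> (\<rat> \<inter> {0<..})" for i :: "'a \<times> real" using that by auto
    fix x :: 'a and r :: real assume r: "0 < r"
    then obtain d where d: "d \<in> D" "dist x d < r / 2"
      using D(2)[of "ball x (r / 2)"] by auto
    \<comment> \<open>The centre has moved by less than \<open>r / 2\<close>, so a radius above
      \<open>r + r / 2\<close> suffices.\<close>
    obtain q where q: "q \<in> \<rat>" "3 * r / 2 < q" "q < 2 * r"
      using Rats_dense_in_real[of "3 * r / 2" "2 * r"] r by auto
    have "ball x r \<subseteq> ball d q"
    proof
      fix z assume "z \<in> ball x r"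
      then have "dist x z < r" by simp
      then show "z \<in> ball d q" using d(2) q(2) dist_triangle[of d z x] by (simp add: dist_commute)
    qed
    then show "\<exists>i\<in>D \<times> (\<rat> \<inter> {0<..}). ball x r \<subseteq> ball (fst i) (snd i) \<and> snd i \<le> 2 * r"
      using d q r by (intro bexI[of _ "(d, q)"]) auto
  qed
  then show ?thesis by blast
qed

lemma ball_in_borel [measurable]: "ball x r \<in> sets borel"
  by simp

definition unit_avg :: "('a::euclidean_space \<Rightarrow> ennreal) \<Rightarrow> ennreal" where
  "unit_avg u = (\<integral>\<^sup>+z\<in>ball 0 1. u z \<partial>lborel) / emeasure lborel (ball (0::'a) 1)"

lemma unit_avg_mono:
  assumes "\<And>z. z \<in> ball 0 1 \<Longrightarrow> u z \<le> v z"
  shows "unit_avg u \<le> unit_avg v"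
  unfolding unit_avg_def using assms
  by (intro divide_right_mono_ennreal nn_integral_mono) (auto simp: indicator_def)

lemma unit_avg_const: "unit_avg (\<lambda>z::'a::euclidean_space. c) = c"
proof -
  have "emeasure lborel (ball (0::'a) 1) \<noteq> 0" "emeasure lborel (ball (0::'a) 1) \<noteq> top"
    by (simp_all add: emeasure_lborel_ball content_ball_pos less_imp_neq[THEN not_sym])
  then show ?thesis
    by (simp add: unit_avg_def nn_integral_cmult_indicator mult_divide_eq_ennreal)
qed

lemma unit_avg_add:
  assumes [measurable]: "u \<in> borel_measurable borel" "v \<in> borel_measurable borel"
  shows "unit_avg (\<lambda>z. u z + v z) = unit_avg u + unit_avg v"
proof -
  have "(\<lambda>z. u z * indicator (ball 0 1) z) \<in> borel_measurable lborel"
       "(\<lambda>z. v z * indicator (ball 0 1) z) \<in> borel_measurable lborel" by measurable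
  from nn_integral_add[OF this] show ?thesis
    by (simp add: unit_avg_def distrib_right add_divide_distrib_ennreal)
qed

lemma unit_avg_cmult:
  assumes [measurable]: "u \<in> borel_measurable borel"
  shows "unit_avg (\<lambda>z. c * u z) = c * unit_avg u"
proof -
  have "(\<lambda>z. u z * indicator (ball 0 1) z) \<in> borel_measurable lborel" by measurable
  from nn_integral_cmult[OF this] show ?thesis
    by (simp add: unit_avg_def mult.assoc ennreal_times_divide)
qed

lemma ball_avg_eq_unit_avg:
  fixes h :: "'a::euclidean_space \<Rightarrow> ennreal"
  assumes [measurable]: "h \<in> borel_measurable borel" and r: "0 < r"
  shows "(\<integral>\<^sup>+y\<in>ball x r. h y \<partial>lborel) / emeasure lborel (ball x r) = unit_avg (\<lambda>z. h (x + r *\<^sub>R z))"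
proof -
  let ?J = "\<integral>\<^sup>+z\<in>ball 0 1. h (x + r *\<^sub>R z) \<partial>lborel"
  define V where "V = measure lborel (ball (0::'a) 1)"
  have V: "0 < V" by (simp add: V_def content_ball_pos)
  have "(\<integral>\<^sup>+y\<in>ball x r. h y \<partial>lborel)
      = ennreal (\<bar>r\<bar> ^ DIM('a)) * (\<integral>\<^sup>+z. h (x + r *\<^sub>R z) * indicator (ball x r) (x + r *\<^sub>R z) \<partial>lborel)"
    using r by (intro nn_integral_lborel_affine borel_measurable_times_ennreal borel_measurable_indicator) auto
  also have "(\<integral>\<^sup>+z. h (x + r *\<^sub>R z) * indicator (ball x r) (x + r *\<^sub>R z) \<partial>lborel) = ?J"
    using r by (intro nn_integral_cong) (auto simp: indicator_def dist_norm)
  finally have 1: "(\<integral>\<^sup>+y\<in>ball x r. h y \<partial>lborel) = ?J * ennreal (r ^ DIM('a))"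
    using r by (simp add: mult.commute)
  have 2: "emeasure lborel (ball x r) = ennreal V * ennreal (r ^ DIM('a))"
    using r content_ball_scale[of 1 r x 0] V
    by (simp add: emeasure_lborel_ball V_def ennreal_mult[symmetric] mult.commute)
  have 3: "emeasure lborel (ball (0::'a) 1) = ennreal V" by (simp add: emeasure_lborel_ball V_def)
  show ?thesis
    unfolding 1 2 unit_avg_def 3 using r by (intro divide_mult_eq) auto
qed

text \<open>The maximal function is evaluated at \<open>c\<close>, which may differ from the centre
  \<open>b\<close>: a member of the net contains \<open>ball c (k * r)\<close>, hence both
  \<open>c\<close> and \<open>ball b r\<close>, and has radius at most
  \<open>2 * k * r\<close>.\<close>

lemma unit_avg_le_max_fun:
  fixes h :: "'a::euclidean_space \<Rightarrow> ennreal"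
  assumes net: "ball_net I" and [measurable]: "h \<in> borel_measurable borel"
    and r: "0 < r" and k: "0 < k" and sub: "ball b r \<subseteq> ball c (k * r)"
  shows "unit_avg (\<lambda>z. h (b + r *\<^sub>R z)) \<le> ennreal ((2 * k) ^ DIM('a)) * max_fun lborel I h c"
proof -
  obtain i where i: "i \<in> I" "ball c (k * r) \<subseteq> ball (fst i) (snd i)" "snd i \<le> 2 * (k * r)"
    using net r k unfolding ball_net_def by (meson mult_pos_pos)
  have si: "0 < snd i" using net i(1) by (auto simp: ball_net_def)
  have ci: "c \<in> ball (fst i) (snd i)" using i(2) r k by (auto simp: subset_eq)
  define V where "V = measure lborel (ball b r)"
  define Vi where "Vi = measure lborel (ball (fst i) (snd i))"
  have V: "0 < V" "0 < Vi" using r si by (simp_all add: V_def Vi_def content_ball_pos)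
  have "Vi = (snd i / r) ^ DIM('a) * V"
    using content_ball_scale[of r "snd i / r" "fst i" b] r si by (simp add: V_def Vi_def)
  also have "\<dots> \<le> (2 * k) ^ DIM('a) * V"
    using i(3) r si V by (intro mult_right_mono power_mono) (auto simp: divide_simps mult_ac)
  finally have le: "1 / V \<le> (2 * k) ^ DIM('a) * (1 / Vi)"
    using V by (simp add: field_simps)
  have "unit_avg (\<lambda>z. h (b + r *\<^sub>R z)) = (\<integral>\<^sup>+y\<in>ball b r. h y \<partial>lborel) * ennreal (1 / V)"
    using r V ball_avg_eq_unit_avg[of h r b]
    by (simp add: emeasure_lborel_ball V_def divide_ennreal_def inverse_ennreal inverse_eq_divide)
  also have "\<dots> \<le> (\<integral>\<^sup>+y\<in>ball (fst i) (snd i). h y \<partial>lborel) * ennreal ((2 * k) ^ DIM('a) * (1 / Vi))"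
    using le subsetD[OF order_trans[OF sub i(2)]]
    by (intro mult_mono nn_integral_mono ennreal_leI) (auto simp: indicator_def simp del: mem_ball)
  also have "\<dots> = ennreal ((2 * k) ^ DIM('a)) * ((\<integral>\<^sup>+y\<in>ball (fst i) (snd i). h y \<partial>lborel) * ennreal (1 / Vi))"
    using k V by (subst ennreal_mult) (auto simp: mult_ac)
  also have "(\<integral>\<^sup>+y\<in>ball (fst i) (snd i). h y \<partial>lborel) * ennreal (1 / Vi)
    = (\<integral>\<^sup>+y\<in>ball (fst i) (snd i). h y \<partial>lborel) / emeasure lborel (ball (fst i) (snd i))"
    using V by (simp add: emeasure_lborel_ball Vi_def divide_ennreal_def inverse_ennreal inverse_eq_divide)
  also have "\<dots> \<le> max_fun lborel I h c" by (rule max_fun_upper[OF i(1) ci])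
  finally show ?thesis by (simp add: mult_left_mono)
qed

text \<open>Extension by 0 outside \<open>G \<times> G\<close> allows maximal functions over the
  whole space; on the diagonal the quotient is 0.\<close>

definition diff_quot :: "'a::euclidean_space set \<Rightarrow> ('a \<Rightarrow> real) \<Rightarrow> real \<Rightarrow> 'a \<Rightarrow> 'a \<Rightarrow> ennreal" where
  "diff_quot G f s x y = (if x \<in> G \<and> y \<in> G then ennreal (\<bar>f x - f y\<bar> / norm (x - y) powr s) else 0)"

lemma diff_quot_sym: "diff_quot G f s x y = diff_quot G f s y x"
  by (auto simp: diff_quot_def norm_minus_commute abs_minus_commute)

lemma diff_quot_measurable:
  assumes [measurable]: "G \<in> sets borel" "f \<in> borel_measurable borel"
  shows "case_prod (diff_quot G f s) \<in> borel_measurable (borel \<Otimes>\<^sub>M borel)"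
  unfolding diff_quot_def[abs_def] case_prod_unfold by measurable

lemma abs_diff_le_diff_quot:
  assumes "x \<in> G" "y \<in> G" "norm (x - y) \<le> r" "0 \<le> s"
  shows "ennreal \<bar>f x - f y\<bar> \<le> ennreal (r powr s) * diff_quot G f s x y"
proof (cases "x = y")
  case False
  let ?n = "norm (x - y) powr s"
  have n: "0 < ?n" using False by simp
  have "\<bar>f x - f y\<bar> = ?n * (\<bar>f x - f y\<bar> / ?n)" using n by simp
  also have "\<dots> \<le> r powr s * (\<bar>f x - f y\<bar> / ?n)"
    using assms by (intro mult_right_mono powr_mono2) auto
  finally show ?thesis
    using assms by (simp add: diff_quot_def ennreal_mult[symmetric] ennreal_leI)
qed simp

text \<open>Every point of the ball is within \<open>D + r <= 3 * D\<close> of \<open>y\<close>, so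
  each value of \<open>f\<close> there is compared with \<open>f y\<close> directly. The distance is
  rounded up to \<open>4 * D\<close> to agree with the case of large radii.\<close>

lemma unit_avg_small_radius:
  fixes f :: "'a::euclidean_space \<Rightarrow> real"
  assumes net: "ball_net I" and [measurable]: "f \<in> borel_measurable borel" and G: "open G"
    and y: "y \<in> G" and sub: "ball x r \<subseteq> G"
    and D: "norm (x - y) \<le> D" "0 < r" "r \<le> 2 * D" and s: "0 \<le> s"
  shows "unit_avg (\<lambda>z. ennreal \<bar>f (x + r *\<^sub>R z)\<bar>) \<le> ennreal \<bar>f y\<bar>
    + ennreal ((4 * D) powr s * 2 ^ DIM('a)) * max_fst I (diff_quot G f s) x y"
proof -
  have [measurable]: "G \<in> sets borel" using G by simp
  note diff_quot_measurable[of G f s, measurable]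
  have "unit_avg (\<lambda>z. ennreal \<bar>f (x + r *\<^sub>R z)\<bar>) \<le> unit_avg (\<lambda>z. ennreal \<bar>f y\<bar>
      + ennreal ((4 * D) powr s) * diff_quot G f s (x + r *\<^sub>R z) y)"
  proof (rule unit_avg_mono)
    fix z :: 'a assume z: "z \<in> ball 0 1"
    then have n: "norm (r *\<^sub>R z) < r" using D by simp
    then have "x + r *\<^sub>R z \<in> ball x r" by (simp add: dist_norm)
    with sub have inG: "x + r *\<^sub>R z \<in> G" by auto
    have "norm (x + r *\<^sub>R z - y) \<le> norm (x - y) + norm (r *\<^sub>R z)"
      using norm_triangle_ineq[of "x - y" "r *\<^sub>R z"] by (simp add: algebra_simps)
    then have "norm (x + r *\<^sub>R z - y) \<le> 4 * D" using n D norm_ge_zero[of "x - y"] by linarith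
    from abs_diff_le_diff_quot[OF inG y this s, of f]
    have "ennreal \<bar>f (x + r *\<^sub>R z) - f y\<bar> \<le> ennreal ((4 * D) powr s) * diff_quot G f s (x + r *\<^sub>R z) y" .
    moreover have "ennreal \<bar>f (x + r *\<^sub>R z)\<bar> \<le> ennreal \<bar>f y\<bar> + ennreal \<bar>f (x + r *\<^sub>R z) - f y\<bar>"
      by (simp flip: ennreal_plus)
    ultimately show "ennreal \<bar>f (x + r *\<^sub>R z)\<bar>
      \<le> ennreal \<bar>f y\<bar> + ennreal ((4 * D) powr s) * diff_quot G f s (x + r *\<^sub>R z) y"
      by (meson add_left_mono order_trans)
  qed
  also have "\<dots> = ennreal \<bar>f y\<bar> + ennreal ((4 * D) powr s) * unit_avg (\<lambda>z. diff_quot G f s (x + r *\<^sub>R z) y)"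
  proof -
    have "(\<lambda>z. diff_quot G f s (x + r *\<^sub>R z) y) \<in> borel_measurable borel" by measurable
    then show ?thesis by (simp add: unit_avg_add unit_avg_cmult unit_avg_const)
  qed
  also have "unit_avg (\<lambda>z. diff_quot G f s (x + r *\<^sub>R z) y) \<le> ennreal ((2 * 1) ^ DIM('a)) * max_fst I (diff_quot G f s) x y"
    unfolding max_fst_def
    by (rule unit_avg_le_max_fun[where h = "\<lambda>z. diff_quot G f s z y", OF net]) (use D in auto)
  finally show ?thesis
    by (simp add: add_left_mono mult_left_mono ennreal_mult mult.assoc)
qed

text \<open>For each \<open>z\<close> the points \<open>a = x + r z\<close> and
  \<open>b = y + q z\<close> are joined through \<open>w\<close> in \<open>ball b D\<close>.
  Averaging over \<open>w\<close> replaces \<open>w\<close> by \<open>y + r z\<close> in the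
  quotient with \<open>a\<close>, and by \<open>x + q z\<close> in the quotient with
  \<open>b\<close>. In both resulting pairs the two entries have the same multiple of
  \<open>z\<close> added, so averaging over \<open>z\<close> gives diagonal maximal functions at
  \<open>(y, x)\<close> and \<open>(x, y)\<close>.\<close>

lemma unit_avg_large_radius:
  fixes f :: "'a::euclidean_space \<Rightarrow> real"
  assumes net: "ball_net I" and [measurable]: "f \<in> borel_measurable borel" and G: "open G"
    and sub: "ball x r \<subseteq> G"
    and D: "norm (x - y) \<le> D" "0 < D" "2 * D < r" and s: "0 \<le> s"
  defines "T \<equiv> max_fst I (diff_quot G f s)"
  shows "unit_avg (\<lambda>z. ennreal \<bar>f (x + r *\<^sub>R z)\<bar>) \<le> unit_avg (\<lambda>z. ennreal \<bar>f (y + (r - 2 * D) *\<^sub>R z)\<bar>)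
    + ennreal ((4 * D) powr s * 12 ^ DIM('a)) * (max_diag I T y x + max_diag I T x y)"
proof -
  have [measurable]: "G \<in> sets borel" using G by simp
  have cI: "countable I" using net by (simp add: ball_net_def)
  note diff_quot_measurable[of G f s, measurable]
  have [measurable]: "case_prod T \<in> borel_measurable (borel \<Otimes>\<^sub>M borel)"
    unfolding T_def by (rule max_fst_measurable[OF cI]) measurable
  define q where "q = r - 2 * D"
  have q: "0 < q" using D by (simp add: q_def)
  let ?c = "ennreal ((4 * D) powr s)"
  have pt: "ennreal \<bar>f (x + r *\<^sub>R z)\<bar> \<le> ennreal \<bar>f (y + q *\<^sub>R z)\<bar> +
      (?c * ennreal (6 ^ DIM('a)) * T (y + r *\<^sub>R z) (x + r *\<^sub>R z) +
       ?c * ennreal (4 ^ DIM('a)) * T (x + q *\<^sub>R z) (y + q *\<^sub>R z))"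
    if z: "z \<in> ball 0 1" for z
  proof -
    define a where "a = x + r *\<^sub>R z"
    define b where "b = y + q *\<^sub>R z"
    have z1: "norm z < 1" using z by simp
    have "norm (r *\<^sub>R z) < r" using z1 D by simp
    then have "a \<in> ball x r" by (simp add: a_def dist_norm)
    then have aG: "a \<in> G" using sub by auto
    have nqz: "norm (q *\<^sub>R z) < q" using z1 q by simp
    have nDz: "norm ((2 * D) *\<^sub>R z) < 2 * D" using z1 D by simp
    \<comment> \<open>The three contributions are \<open>D\<close> from the centres, less than
      \<open>q = r - 2 * D\<close> from \<open>q z\<close>, and less than \<open>D\<close> from the
      small ball: in total less than \<open>r\<close>.\<close>
    have bD: "ball b D \<subseteq> ball x r"
    proof
      fix w assume "w \<in> ball b D"
      then have w: "norm (b - w) < D" by (simp add: dist_norm)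
      have "norm (x - w) = norm ((x - y) - q *\<^sub>R z + (b - w))" by (simp add: b_def)
      then have "norm (x - w) \<le> norm (x - y) + norm (q *\<^sub>R z) + norm (b - w)"
        using norm_triangle_ineq[of "(x - y) - q *\<^sub>R z" "b - w"] norm_triangle_ineq4[of "x - y" "q *\<^sub>R z"] by linarith
      then show "w \<in> ball x r" using w nqz D unfolding mem_ball dist_norm q_def by linarith
    qed
    then have bG: "b \<in> G" using sub D by (auto simp: subset_eq)
    have ab: "norm (b - a) \<le> 3 * D"
    proof -
      have "b - a = - ((x - y) + (2 * D) *\<^sub>R z)" by (simp add: a_def b_def q_def algebra_simps)
      then have "norm (b - a) \<le> norm (x - y) + norm ((2 * D) *\<^sub>R z)"
        using norm_triangle_ineq[of "x - y" "(2 * D) *\<^sub>R z"] by (metis norm_minus_cancel)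
      then show ?thesis using nDz D by linarith
    qed
    have "ennreal \<bar>f a - f b\<bar> = unit_avg (\<lambda>e::'a. ennreal \<bar>f a - f b\<bar>)" by (simp add: unit_avg_const)
    \<comment> \<open>Every intermediate point is within \<open>D\<close> of \<open>b\<close>, hence
      within \<open>D + 3 * D\<close> of \<open>a\<close>.\<close>
    also have "\<dots> \<le> unit_avg (\<lambda>e. ?c * diff_quot G f s (b + D *\<^sub>R e) a + ?c * diff_quot G f s (b + D *\<^sub>R e) b)"
    proof (rule unit_avg_mono)
      fix e :: 'a assume "e \<in> ball 0 1"
      then have e: "norm (D *\<^sub>R e) < D" using D by simp
      define w where "w = b + D *\<^sub>R e"
      have "w \<in> ball b D" using e by (simp add: w_def dist_norm)
      then have wG: "w \<in> G" using bD sub by auto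
      have "norm (w - b) \<le> 4 * D" using e D by (simp add: w_def)
      note 1 = abs_diff_le_diff_quot[OF wG bG this s, of f]
      have "norm (w - a) \<le> norm (b - a) + norm (D *\<^sub>R e)"
        using norm_triangle_ineq[of "b - a" "D *\<^sub>R e"] by (simp add: w_def algebra_simps)
      then have "norm (w - a) \<le> 4 * D" using ab e D by linarith
      note 2 = abs_diff_le_diff_quot[OF wG aG this s, of f]
      have "ennreal \<bar>f a - f b\<bar> \<le> ennreal \<bar>f w - f a\<bar> + ennreal \<bar>f w - f b\<bar>"
        by (simp flip: ennreal_plus)
      also have "\<dots> \<le> ?c * diff_quot G f s w a + ?c * diff_quot G f s w b"
        by (intro add_mono 1 2)
      finally show "ennreal \<bar>f a - f b\<bar> \<le> ?c * diff_quot G f s (b + D *\<^sub>R e) a + ?c * diff_quot G f s (b + D *\<^sub>R e) b"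
        by (simp add: w_def)
    qed
    also have "\<dots> = ?c * unit_avg (\<lambda>e. diff_quot G f s (b + D *\<^sub>R e) a) + ?c * unit_avg (\<lambda>e. diff_quot G f s (b + D *\<^sub>R e) b)"
    proof -
      have "(\<lambda>e. diff_quot G f s (b + D *\<^sub>R e) u) \<in> borel_measurable borel" for u by measurable
      then show ?thesis by (simp add: unit_avg_add unit_avg_cmult)
    qed
    also have "\<dots> \<le> ?c * (ennreal (6 ^ DIM('a)) * T (y + r *\<^sub>R z) a) + ?c * (ennreal (4 ^ DIM('a)) * T (x + q *\<^sub>R z) b)"
    proof (intro add_mono mult_left_mono)
      \<comment> \<open>The centre \<open>b\<close> differs from \<open>y + r z\<close> by
        \<open>2 * D * z\<close>; the dilation 3 is doubled by the net, whence
        \<open>6 ^ DIM('a)\<close>.\<close>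
      have "ball b D \<subseteq> ball (y + r *\<^sub>R z) (3 * D)"
      proof
        fix w assume "w \<in> ball b D"
        then have w: "norm (b - w) < D" by (simp add: dist_norm)
        have "(y + r *\<^sub>R z) - w = (2 * D) *\<^sub>R z + (b - w)" by (simp add: b_def q_def algebra_simps)
        then have "norm ((y + r *\<^sub>R z) - w) \<le> norm ((2 * D) *\<^sub>R z) + norm (b - w)"
          by (metis norm_triangle_ineq)
        then show "w \<in> ball (y + r *\<^sub>R z) (3 * D)" using w nDz unfolding mem_ball dist_norm by linarith
      qed
      from unit_avg_le_max_fun[where h = "\<lambda>w. diff_quot G f s w a", OF net _ D(2) _ this]
      show "unit_avg (\<lambda>e. diff_quot G f s (b + D *\<^sub>R e) a) \<le> ennreal (6 ^ DIM('a)) * T (y + r *\<^sub>R z) a"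
        by (simp add: T_def max_fst_def)
      \<comment> \<open>Here the centres differ by \<open>x - y\<close> only, so the dilation is 2
        and the factor \<open>4 ^ DIM('a)\<close>.\<close>
      have "ball b D \<subseteq> ball (x + q *\<^sub>R z) (2 * D)"
      proof
        fix w assume "w \<in> ball b D"
        then have w: "norm (b - w) < D" by (simp add: dist_norm)
        have "(x + q *\<^sub>R z) - w = (x - y) + (b - w)" by (simp add: b_def)
        then have "norm ((x + q *\<^sub>R z) - w) \<le> norm (x - y) + norm (b - w)"
          by (metis norm_triangle_ineq)
        then show "w \<in> ball (x + q *\<^sub>R z) (2 * D)" using w D(1) unfolding mem_ball dist_norm by linarith
      qed
      from unit_avg_le_max_fun[where h = "\<lambda>w. diff_quot G f s w b", OF net _ D(2) _ this]
      show "unit_avg (\<lambda>e. diff_quot G f s (b + D *\<^sub>R e) b) \<le> ennreal (4 ^ DIM('a)) * T (x + q *\<^sub>R z) b"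
        by (simp add: T_def max_fst_def)
    qed auto
    finally have "ennreal \<bar>f a - f b\<bar> \<le>
      ?c * ennreal (6 ^ DIM('a)) * T (y + r *\<^sub>R z) a + ?c * ennreal (4 ^ DIM('a)) * T (x + q *\<^sub>R z) b"
      by (simp only: mult.assoc)
    moreover have "ennreal \<bar>f a\<bar> \<le> ennreal \<bar>f b\<bar> + ennreal \<bar>f a - f b\<bar>"
      by (simp flip: ennreal_plus)
    ultimately show ?thesis unfolding a_def b_def by (meson add_left_mono order_trans)
  qed
  \<comment> \<open>Both arguments move by \<open>r z\<close>, so this is the average of
    \<open>w \<mapsto> T w (w + (x - y))\<close> over the ball of radius \<open>r\<close> about
    \<open>y\<close>.\<close>
  have 1: "unit_avg (\<lambda>z. T (y + r *\<^sub>R z) (x + r *\<^sub>R z)) \<le> ennreal (2 ^ DIM('a)) * max_diag I T y x"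
  proof -
    have "(\<lambda>w. T w (w + (x - y))) \<in> borel_measurable borel" by measurable
    from unit_avg_le_max_fun[OF net this, of r 1 y y]
    show ?thesis using D by (simp add: max_diag_def algebra_simps)
  qed
  have 2: "unit_avg (\<lambda>z. T (x + q *\<^sub>R z) (y + q *\<^sub>R z)) \<le> ennreal (2 ^ DIM('a)) * max_diag I T x y"
  proof -
    have "(\<lambda>w. T w (w + (y - x))) \<in> borel_measurable borel" by measurable
    from unit_avg_le_max_fun[OF net this, of q 1 x x]
    show ?thesis using q by (simp add: max_diag_def algebra_simps)
  qed
  have "unit_avg (\<lambda>z. ennreal \<bar>f (x + r *\<^sub>R z)\<bar>) \<le> unit_avg (\<lambda>z. ennreal \<bar>f (y + q *\<^sub>R z)\<bar> +
      (?c * ennreal (6 ^ DIM('a)) * T (y + r *\<^sub>R z) (x + r *\<^sub>R z) +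
       ?c * ennreal (4 ^ DIM('a)) * T (x + q *\<^sub>R z) (y + q *\<^sub>R z)))"
    by (rule unit_avg_mono) (rule pt)
  also have "\<dots> = unit_avg (\<lambda>z. ennreal \<bar>f (y + q *\<^sub>R z)\<bar>) +
      (?c * ennreal (6 ^ DIM('a)) * unit_avg (\<lambda>z. T (y + r *\<^sub>R z) (x + r *\<^sub>R z)) +
       ?c * ennreal (4 ^ DIM('a)) * unit_avg (\<lambda>z. T (x + q *\<^sub>R z) (y + q *\<^sub>R z)))"
  proof -
    have "(\<lambda>z. T (u + k *\<^sub>R z) (v + k *\<^sub>R z)) \<in> borel_measurable borel" for u v k by measurable
    then show ?thesis by (simp add: unit_avg_add unit_avg_cmult)
  qed
  \<comment> \<open>The smaller factor \<open>4 ^ DIM('a)\<close> is raised to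
    \<open>6 ^ DIM('a)\<close> to share a common constant.\<close>
  also have "\<dots> \<le> unit_avg (\<lambda>z. ennreal \<bar>f (y + q *\<^sub>R z)\<bar>) +
      (?c * ennreal (6 ^ DIM('a)) * (ennreal (2 ^ DIM('a)) * max_diag I T y x) +
       ?c * ennreal (6 ^ DIM('a)) * (ennreal (2 ^ DIM('a)) * max_diag I T x y))"
    by (intro add_left_mono add_mono mult_mono 1 2 ennreal_leI power_mono) auto
  also have "\<dots> = unit_avg (\<lambda>z. ennreal \<bar>f (y + q *\<^sub>R z)\<bar>) +
      ennreal ((4 * D) powr s * 12 ^ DIM('a)) * (max_diag I T y x + max_diag I T x y)"
  proof -
    have "(12::real) ^ DIM('a) = 6 ^ DIM('a) * 2 ^ DIM('a)" by (simp flip: power_mult_distrib)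
    then have "ennreal ((4 * D) powr s * 12 ^ DIM('a)) = ?c * ennreal (6 ^ DIM('a)) * ennreal (2 ^ DIM('a))"
      by (simp add: ennreal_mult mult.assoc)
    then show ?thesis by (simp only: distrib_left mult.assoc)
  qed
  finally show ?thesis by (simp add: q_def)
qed

subsection \<open>The pointwise bound and its norm\<close>

lemma ball_average_lborel:
  fixes f :: "real^'n \<Rightarrow> real"
  shows "ball_average f x r = (if r = 0 then ennreal \<bar>f x\<bar>
    else (\<integral>\<^sup>+y\<in>ball x r. ennreal \<bar>f y\<bar> \<partial>lborel) / emeasure lborel (ball x r))"
  by (simp add: ball_average_def nn_integral_completion)

lemma ball_average_unit_avg:
  fixes f :: "real^'n \<Rightarrow> real"
  assumes [measurable]: "f \<in> borel_measurable borel" and "0 < r"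
  shows "ball_average f x r = unit_avg (\<lambda>z. ennreal \<bar>f (x + r *\<^sub>R z)\<bar>)"
  using assms(2) ball_avg_eq_unit_avg[of "\<lambda>y. ennreal \<bar>f y\<bar>" r x] by (simp add: ball_average_lborel)

lemma ball_average_le_maximal_op:
  assumes "0 \<le> r" "r \<le> R x"
  shows "ball_average f x r \<le> maximal_op R f x"
  unfolding maximal_op_def using assms by (intro SUP_upper) auto

text \<open>The terms with exchanged arguments make the majorant symmetric for symmetric
  \<open>F\<close>, so it serves both one-sided estimates. Nesting to the right fits the repeated
  splitting of its power.\<close>

definition diff_bound :: "('a::euclidean_space \<times> real) set \<Rightarrow> ('a \<Rightarrow> 'a \<Rightarrow> ennreal) \<Rightarrow> 'a \<Rightarrow> 'a \<Rightarrow> ennreal" where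
  "diff_bound I F x y = F x y + (max_fst I F x y + (max_fst I F y x +
     (max_diag I (max_fst I F) x y + max_diag I (max_fst I F) y x)))"

lemma diff_bound_sym:
  assumes "\<And>x y. F x y = F y x"
  shows "diff_bound I F x y = diff_bound I F y x"
  unfolding diff_bound_def assms[of x y] by (simp add: add_ac)

lemma max_diag_le_diff_bound:
  "max_diag I (max_fst I F) y x + max_diag I (max_fst I F) x y \<le> diff_bound I F x y"
  unfolding diff_bound_def add.commute[of "max_diag I (max_fst I F) y x"]
  by (rule add_increasing[OF zero_le], rule add_increasing[OF zero_le],
      rule add_increasing[OF zero_le], rule order_refl)

text \<open>The ranges \<open>r = 0\<close>, \<open>0 < r <= 2 * D\<close> and
  \<open>2 * D < r\<close> account for the terms with \<open>F\<close>, \<open>max_fst\<close> and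
  \<open>max_diag\<close>; the largest constant, with \<open>12 ^ DIM(real^'n)\<close>, covers all
  three. Stating one direction at a time avoids subtraction of possibly infinite values.\<close>

lemma maximal_op_le:
  fixes f :: "real^'n \<Rightarrow> real"
  assumes net: "ball_net I" and f: "f \<in> borel_measurable borel" and G: "open G"
    and R: "\<And>x. x \<in> G \<Longrightarrow> 0 \<le> R x \<and> ball x (R x) \<subseteq> G"
    and x: "x \<in> G" and y: "y \<in> G" and xy: "x \<noteq> y" and s: "0 \<le> s"
  defines "D \<equiv> norm (x - y) + \<bar>R x - R y\<bar>"
  shows "maximal_op R f x \<le> maximal_op R f y
    + ennreal ((4 * D) powr s * 12 ^ DIM(real^'n)) * diff_bound I (diff_quot G f s) x y"
proof -
  let ?F = "diff_quot G f s"
  let ?B = "diff_bound I ?F x y"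
  let ?c = "ennreal ((4 * D) powr s * 12 ^ DIM(real^'n))"
  have RD: "R x - R y \<le> D" unfolding D_def by (intro add_increasing) auto
  have D: "norm (x - y) \<le> D" "0 < D" using xy by (auto simp: D_def add_pos_nonneg)
  have "ball_average f x r \<le> maximal_op R f y + ?c * ?B" if r: "r \<in> {0..R x}" for r
  proof -
    have sub: "ball x r \<subseteq> G" using R[OF x] r subset_ball[of r "R x" x] by auto
    have fy: "ennreal \<bar>f y\<bar> \<le> maximal_op R f y"
      using ball_average_le_maximal_op[of 0 R y f] R[OF y] by (simp add: ball_average_def)
    consider "r = 0" | "0 < r" "r \<le> 2 * D" | "2 * D < r" using r by fastforce
    then show ?thesis
    proof cases
      case 1
      have "norm (x - y) \<le> 4 * D" using D norm_ge_zero[of "x - y"] by linarith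
      from abs_diff_le_diff_quot[OF x y this s, of f]
      have "ennreal \<bar>f x - f y\<bar> \<le> ennreal ((4 * D) powr s) * ?F x y" .
      also have "\<dots> \<le> ?c * ?B"
        unfolding diff_bound_def
        by (intro mult_mono ennreal_leI) (auto simp: mult_le_cancel_left1 intro!: add_increasing2)
      finally have *: "ennreal \<bar>f x - f y\<bar> \<le> ?c * ?B" .
      have "ennreal \<bar>f x\<bar> \<le> ennreal \<bar>f y\<bar> + ennreal \<bar>f x - f y\<bar>" by (simp flip: ennreal_plus)
      also have "\<dots> \<le> maximal_op R f y + ?c * ?B" by (intro add_mono fy *)
      finally show ?thesis using 1 by (simp add: ball_average_def)
    next
      case 2
      have "ball_average f x r \<le> ennreal \<bar>f y\<bar> + ennreal ((4 * D) powr s * 2 ^ DIM(real^'n)) * max_fst I ?F x y"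
        using unit_avg_small_radius[OF net f G y sub D(1) 2 s] 2(1) f by (simp add: ball_average_unit_avg)
      also have "\<dots> \<le> maximal_op R f y + ?c * ?B"
        unfolding diff_bound_def
        by (intro add_mono fy mult_mono ennreal_leI power_mono)
          (auto intro!: add_increasing2[of _ "max_fst I ?F x y"] add_increasing[of "?F x y"])
      finally show ?thesis .
    next
      case 3
      have rx: "r \<le> R x" using r by simp
      \<comment> \<open>The reduced radius is admissible at \<open>y\<close> because
        \<open>r <= R x <= R y + D\<close>; this is why \<open>D\<close> includes the difference of
        the radii.\<close>
      have ry: "r - 2 * D \<le> R y" 
using rx RD D(2) by linarith
      have "ball_average f x r \<le> ball_average f y (r - 2 * D) +
          ?c * (max_diag I (max_fst I ?F) y x + max_diag I (max_fst I ?F) x y)"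
        using unit_avg_large_radius[OF net f G sub D 3 s] 3 D f by (simp add: ball_average_unit_avg)
      also have "\<dots> \<le> maximal_op R f y + ?c * ?B"
        using 3 ry
        by (intro add_mono mult_left_mono ball_average_le_maximal_op max_diag_le_diff_bound) auto
      finally show ?thesis .
    qed
  qed
  then show ?thesis unfolding maximal_op_def[of R f x] by (rule SUP_least)
qed

text \<open>If both values were infinite, the one-sided bounds would say nothing while the
  difference is infinite by definition; finiteness of \<open>a\<close> excludes this.\<close>

lemma ennreal_absdiff_le:
  assumes "a \<le> b + c" "b \<le> a + c" "a \<noteq> top"
  shows "ennreal_absdiff a b \<le> c"
proof (cases "a \<le> b")
  case True
  then have "a - b = 0" using assms(3) by (intro diff_eq_0_ennreal) (auto simp: less_top)
  then show ?thesis using assms by (simp add: ennreal_absdiff_def ennreal_minus_le_iff)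
next
  case False
  then have "b - a = 0" by (intro diff_eq_0_ennreal) (auto simp: not_le less_le_trans)
  then show ?thesis using assms by (simp add: ennreal_absdiff_def ennreal_minus_le_iff)
qed

text \<open>One step in splitting the power of a right-nested sum: the constant for the tail is at
  least 1, so it can also be put in front of the new term.\<close>

lemma ennreal_powr_add_step:
  assumes "ennreal_powr X p \<le> ennreal k * Y" "1 \<le> k" "0 \<le> p"
  shows "ennreal_powr (a + X) p \<le> ennreal (2 powr p * k) * (ennreal_powr a p + Y)"
proof -
  have "ennreal_powr (a + X) p \<le> ennreal (2 powr p) * (ennreal_powr a p + ennreal_powr X p)"
    by (rule ennreal_powr_add_le[OF assms(3)])
  also have "\<dots> \<le> ennreal (2 powr p) * (ennreal k * ennreal_powr a p + ennreal k * Y)"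
  proof (intro mult_left_mono add_mono assms(1))
    have "ennreal_powr a p * 1 \<le> ennreal_powr a p * ennreal k"
      using assms(2) by (intro mult_left_mono) (auto simp: ennreal_ge_1)
    then show "ennreal_powr a p \<le> ennreal k * ennreal_powr a p" by (simp add: mult.commute)
  qed auto
  also have "\<dots> = ennreal (2 powr p * k) * (ennreal_powr a p + Y)"
    using assms(2) by (simp add: ennreal_mult distrib_left mult.assoc)
  finally show ?thesis .
qed

lemma diff_bound_powr_le:
  assumes p: "0 \<le> p"
  shows "ennreal_powr (diff_bound I F x y) p \<le> ennreal ((2 powr p) ^ 4) *
    (ennreal_powr (F x y) p + (ennreal_powr (max_fst I F x y) p + (ennreal_powr (max_fst I F y x) p +
     (ennreal_powr (max_diag I (max_fst I F) x y) p + ennreal_powr (max_diag I (max_fst I F) y x) p))))"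
proof -
  have 1: "1 \<le> 2 powr p" using p by (simp add: ge_one_powr_ge_zero)
  have 2: "1 \<le> 2 powr p * 2 powr p" "1 \<le> 2 powr p * (2 powr p * 2 powr p)"
    using mult_mono[OF 1 1] mult_mono[OF 1 mult_mono[OF 1 1]] by simp_all
  have "(2 powr p) ^ 4 = 2 powr p * (2 powr p * (2 powr p * 2 powr p))"
    by (simp add: power4_eq_xxxx mult.assoc)
  then show ?thesis
    unfolding diff_bound_def
    using ennreal_powr_add_step[OF ennreal_powr_add_step[OF ennreal_powr_add_step[OF
        ennreal_powr_add_le[OF p] 1 p] 2(1) p] 2(2) p]
    by simp
qed

lemma nn_integral_swap_weight:
  fixes H :: "'a::euclidean_space \<Rightarrow> 'a \<Rightarrow> ennreal"
  assumes [measurable]: "case_prod H \<in> borel_measurable (borel \<Otimes>\<^sub>M borel)" "w \<in> borel_measurable borel"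
  shows "(\<integral>\<^sup>+x. (\<integral>\<^sup>+y. H y x * ennreal (w (x - y)) \<partial>lborel) \<partial>lborel)
    = (\<integral>\<^sup>+x. (\<integral>\<^sup>+y. H x y * ennreal (w (- (x - y))) \<partial>lborel) \<partial>lborel)"
proof -
  have [measurable]: "(\<lambda>u. H (snd u) (fst u)) \<in> borel_measurable (borel \<Otimes>\<^sub>M borel)"
    using measurable_compose[OF measurable_Pair[OF measurable_snd measurable_fst] assms(1)] by simp
  have "(\<lambda>(x, y). H y x * ennreal (w (x - y))) \<in> borel_measurable (lborel \<Otimes>\<^sub>M lborel)"
    unfolding case_prod_unfold by measurable
  from lborel_pair.Fubini'[OF this, symmetric] show ?thesis by simp
qed

text \<open>The five summands belong to the five terms of \<open>diff_bound\<close>, in the same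
  order; \<open>L\<close> is the strong type constant for Lebesgue measure, and the fourth power
  stems from four splittings of the sum.\<close>

definition diff_bound_const :: "nat \<Rightarrow> real \<Rightarrow> real \<Rightarrow> real" where
  "diff_bound_const n p A = (let M = muckenhoupt_const n p A; L = 2 powr p * p * 5 ^ n / (p - 1) in
     (2 powr p) ^ 4 * (1 + (M + (M + (L * M + L * M)))))"

lemma muckenhoupt_const_nonneg: "1 < p \<Longrightarrow> 0 < A \<Longrightarrow> 0 \<le> muckenhoupt_const n p A"
  unfolding muckenhoupt_const_def Let_def
  by (intro mult_nonneg_nonneg divide_nonneg_nonneg) (auto simp: field_simps)

text \<open>Terms with exchanged arguments are estimated with the reflected weight
  \<open>w'\<close>, which satisfies the same \<open>A_p\<close> bound. The diagonal operator acts
  on \<open>T\<close>, so it costs \<open>L\<close> on top of the bound \<open>M\<close> for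
  \<open>T\<close>.\<close>

lemma diff_bound_strong_type:
  fixes F :: "'a::euclidean_space \<Rightarrow> 'a \<Rightarrow> ennreal"
  assumes p: "1 < p" and A: "0 < A" and w: "ball_Ap p A w" and net: "ball_net I"
    and F[measurable]: "case_prod F \<in> borel_measurable (borel \<Otimes>\<^sub>M borel)"
    and sym: "\<And>x y. F x y = F y x"
  shows "(\<integral>\<^sup>+x. (\<integral>\<^sup>+y. ennreal_powr (diff_bound I F x y) p * ennreal (w (x - y)) \<partial>lborel) \<partial>lborel)
    \<le> ennreal (diff_bound_const DIM('a) p A) *
      (\<integral>\<^sup>+x. (\<integral>\<^sup>+y. ennreal_powr (F x y) p * ennreal (w (x - y)) \<partial>lborel) \<partial>lborel)"
proof -
  have [measurable]: "w \<in> borel_measurable borel" using w by (auto simp: ball_Ap_def)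
  have I: "\<And>i. i \<in> I \<Longrightarrow> 0 < snd i" and cI: "countable I" using net by (auto simp: ball_net_def)
  define w' where "w' x = w (- x)" for x
  have w': "ball_Ap p A w'" using ball_Ap_reflect[OF w] by (simp add: w'_def[abs_def])
  have [measurable]: "w' \<in> borel_measurable borel" using w' by (auto simp: ball_Ap_def)
  define T where "T = max_fst I F"
  have T[measurable]: "case_prod T \<in> borel_measurable (borel \<Otimes>\<^sub>M borel)"
    unfolding T_def by (rule max_fst_measurable[OF cI F])
  define S where "S = max_diag I T"
  have S[measurable]: "case_prod S \<in> borel_measurable (borel \<Otimes>\<^sub>M borel)"
    unfolding S_def by (rule max_diag_measurable[OF cI T])
  define \<Phi> where "\<Phi> H v = (\<integral>\<^sup>+x. (\<integral>\<^sup>+y. ennreal_powr (H x y) p * ennreal (v (x - y)) \<partial>lborel) \<partial>lborel)"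
    for H :: "'a \<Rightarrow> 'a \<Rightarrow> ennreal" and v :: "'a \<Rightarrow> real"
  define M where "M = muckenhoupt_const DIM('a) p A"
  define L where "L = 2 powr p * p * 5 ^ DIM('a) / (p - 1)"
  have nonneg: "0 \<le> M" "0 \<le> L" using muckenhoupt_const_nonneg[OF p A] p by (auto simp: M_def L_def)
  have swap: "(\<integral>\<^sup>+x. (\<integral>\<^sup>+y. ennreal_powr (H y x) p * ennreal (w (x - y)) \<partial>lborel) \<partial>lborel) = \<Phi> H w'"
    if [measurable]: "case_prod H \<in> borel_measurable (borel \<Otimes>\<^sub>M borel)" for H
    unfolding \<Phi>_def w'_def by (rule nn_integral_swap_weight) measurable
  \<comment> \<open>Symmetry of \<open>F\<close> brings the estimates for \<open>w'\<close> back to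
    the same right-hand side.\<close>
  have Fw': "\<Phi> F w' = \<Phi> F w"
    unfolding swap[OF F, symmetric] by (simp add: \<Phi>_def sym)
  have Tw: "\<Phi> T w \<le> ennreal M * \<Phi> F w"
    unfolding \<Phi>_def T_def M_def by (rule max_fst_strong_type[OF p A w I cI F])
  have Tw': "\<Phi> T w' \<le> ennreal M * \<Phi> F w"
    unfolding Fw'[symmetric] unfolding \<Phi>_def T_def M_def by (rule max_fst_strong_type[OF p A w' I cI F])
  have S_le: "\<Phi> S v \<le> ennreal L * \<Phi> T v" if "v \<in> borel_measurable borel" for v
    unfolding \<Phi>_def S_def L_def by (rule max_diag_strong_type[OF p that I cI T])
  have LM: "ennreal L * (ennreal M * X) = ennreal (L * M) * X" for X
    using nonneg by (simp add: ennreal_mult mult.assoc)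
  have Sw: "\<Phi> S w \<le> ennreal (L * M) * \<Phi> F w"
    using order_trans[OF S_le mult_left_mono[OF Tw]] by (simp add: LM)
  have Sw': "\<Phi> S w' \<le> ennreal (L * M) * \<Phi> F w"
    using order_trans[OF S_le mult_left_mono[OF Tw']] by (simp add: LM)
  have "(\<integral>\<^sup>+x. (\<integral>\<^sup>+y. ennreal_powr (diff_bound I F x y) p * ennreal (w (x - y)) \<partial>lborel) \<partial>lborel)
    \<le> (\<integral>\<^sup>+x. (\<integral>\<^sup>+y. ennreal ((2 powr p) ^ 4) * (ennreal_powr (F x y) p * ennreal (w (x - y))
      + (ennreal_powr (T x y) p * ennreal (w (x - y)) + (ennreal_powr (T y x) p * ennreal (w (x - y))
      + (ennreal_powr (S x y) p * ennreal (w (x - y)) + ennreal_powr (S y x) p * ennreal (w (x - y)))))) \<partial>lborel) \<partial>lborel)"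
  proof (intro nn_integral_mono)
    fix x y :: 'a
    have "ennreal_powr (diff_bound I F x y) p * ennreal (w (x - y)) \<le> ennreal ((2 powr p) ^ 4) *
      (ennreal_powr (F x y) p + (ennreal_powr (T x y) p + (ennreal_powr (T y x) p +
       (ennreal_powr (S x y) p + ennreal_powr (S y x) p)))) * ennreal (w (x - y))"
      unfolding S_def T_def using p by (intro mult_right_mono diff_bound_powr_le) auto
    then show "ennreal_powr (diff_bound I F x y) p * ennreal (w (x - y))
      \<le> ennreal ((2 powr p) ^ 4) * (ennreal_powr (F x y) p * ennreal (w (x - y))
      + (ennreal_powr (T x y) p * ennreal (w (x - y)) + (ennreal_powr (T y x) p * ennreal (w (x - y))
      + (ennreal_powr (S x y) p * ennreal (w (x - y)) + ennreal_powr (S y x) p * ennreal (w (x - y))))))"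
      by (simp only: distrib_right mult.assoc)
  qed
  also have "\<dots> = ennreal ((2 powr p) ^ 4) * (\<Phi> F w + (\<Phi> T w + (\<Phi> T w' + (\<Phi> S w + \<Phi> S w'))))"
  proof -
    have add: "(\<integral>\<^sup>+x. (\<integral>\<^sup>+y. H x y + K x y \<partial>lborel) \<partial>lborel)
      = (\<integral>\<^sup>+x. (\<integral>\<^sup>+y. H x y \<partial>lborel) \<partial>lborel) + (\<integral>\<^sup>+x. (\<integral>\<^sup>+y. K x y \<partial>lborel) \<partial>lborel)"
      if [measurable]: "case_prod H \<in> borel_measurable (borel \<Otimes>\<^sub>M borel)"
        "case_prod K \<in> borel_measurable (borel \<Otimes>\<^sub>M borel)" for H K :: "'a \<Rightarrow> 'a \<Rightarrow> ennreal"
    proof -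
      have "(\<integral>\<^sup>+x. (\<integral>\<^sup>+y. H x y + K x y \<partial>lborel) \<partial>lborel)
        = (\<integral>\<^sup>+x. (\<integral>\<^sup>+y. H x y \<partial>lborel) + (\<integral>\<^sup>+y. K x y \<partial>lborel) \<partial>lborel)"
        by (intro nn_integral_cong nn_integral_add) measurable
      also have "\<dots> = (\<integral>\<^sup>+x. (\<integral>\<^sup>+y. H x y \<partial>lborel) \<partial>lborel) + (\<integral>\<^sup>+x. (\<integral>\<^sup>+y. K x y \<partial>lborel) \<partial>lborel)"
        by (rule nn_integral_add) measurable
      finally show ?thesis .
    qed
    have cmult: "(\<integral>\<^sup>+x. (\<integral>\<^sup>+y. c * H x y \<partial>lborel) \<partial>lborel) = c * (\<integral>\<^sup>+x. (\<integral>\<^sup>+y. H x y \<partial>lborel) \<partial>lborel)"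
      if [measurable]: "case_prod H \<in> borel_measurable (borel \<Otimes>\<^sub>M borel)" for H :: "'a \<Rightarrow> 'a \<Rightarrow> ennreal" and c
    proof -
      have "(\<integral>\<^sup>+x. (\<integral>\<^sup>+y. c * H x y \<partial>lborel) \<partial>lborel) = (\<integral>\<^sup>+x. c * (\<integral>\<^sup>+y. H x y \<partial>lborel) \<partial>lborel)"
        by (intro nn_integral_cong nn_integral_cmult) measurable
      also have "\<dots> = c * (\<integral>\<^sup>+x. (\<integral>\<^sup>+y. H x y \<partial>lborel) \<partial>lborel)"
        by (rule nn_integral_cmult) measurable
      finally show ?thesis .
    qed
    show ?thesis
      by (subst cmult, measurable, subst add, measurable, subst add, measurable, subst add, measurable,
          subst add, measurable) (simp add: swap \<Phi>_def[symmetric])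
  qed
  also have "\<dots> \<le> ennreal ((2 powr p) ^ 4) * (\<Phi> F w + (ennreal M * \<Phi> F w + (ennreal M * \<Phi> F w
      + (ennreal (L * M) * \<Phi> F w + ennreal (L * M) * \<Phi> F w))))"
    by (intro mult_left_mono add_mono Tw Tw' Sw Sw') auto
  also have "\<dots> = ennreal ((2 powr p) ^ 4 * (1 + (M + (M + (L * M + L * M))))) * \<Phi> F w"
  proof -
    have "ennreal (1 + (M + (M + (L * M + L * M)))) = 1 + (ennreal M + (ennreal M + (ennreal (L * M) + ennreal (L * M))))"
      using nonneg mult_nonneg_nonneg[OF nonneg(2,1)]
      by (simp only: ennreal_plus add_nonneg_nonneg zero_le_one ennreal_1)
    then show ?thesis using nonneg
      by (subst ennreal_mult) (simp_all only: distrib_right mult_1_left mult.assoc, auto)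
  qed
  finally show ?thesis by (simp only: \<Phi>_def diff_bound_const_def M_def L_def Let_def)
qed

subsection \<open>The estimate for Borel functions\<close>

text \<open>The number 16 bounds \<open>4 powr s\<close> for all \<open>s <= 2\<close>.\<close>

definition fractional_bound_const :: "nat \<Rightarrow> real \<Rightarrow> real \<Rightarrow> real" where
  "fractional_bound_const n p A = (16 * 12 ^ n) powr p * diff_bound_const n p A"

lemma diff_quot_powr:
  assumes "x \<in> G" "y \<in> G"
  shows "ennreal_powr (diff_quot G f s x y) p = ennreal (\<bar>f x - f y\<bar> powr p / norm (x - y) powr (s * p))"
  using assms by (simp add: diff_quot_def powr_divide powr_powr)

text \<open>Positive radii contribute at most a multiple of the maximal function of
  \<open>f\<close>, which has a finite \<open>p\<close>-norm; the radius 0 contributes the real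
  number \<open>\<bar>f x\<bar>\<close>.\<close>

lemma maximal_op_finite_AE:
  fixes f :: "real^'n \<Rightarrow> real" and I :: "((real^'n) \<times> real) set"
  assumes p: "1 < p" and net: "ball_net I" and [measurable]: "f \<in> borel_measurable borel"
    and fin: "(\<integral>\<^sup>+x. ennreal (\<bar>f x\<bar> powr p) \<partial>lborel) < \<infinity>"
  shows "AE x in lborel. maximal_op R f x \<noteq> top"
proof -
  have I: "\<And>i. i \<in> I \<Longrightarrow> 0 < snd i" and cI: "countable I" using net by (auto simp: ball_net_def)
  let ?M = "max_fun lborel I (\<lambda>x. ennreal \<bar>f x\<bar>)"
  have [measurable]: "?M \<in> borel_measurable borel" by (rule max_fun_measurable[OF cI])
  have "(\<integral>\<^sup>+x. ennreal_powr (?M x) p \<partial>lborel)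
      \<le> ennreal (2 powr p * p * 5 ^ DIM(real^'n) / (p - 1)) * (\<integral>\<^sup>+x. ennreal (\<bar>f x\<bar> powr p) \<partial>lborel)"
    using max_fun_strong_type[OF doubling_lborel I cI sigma_finite_lborel, of "\<lambda>x. ennreal \<bar>f x\<bar>" p] p by simp
  also have "\<dots> < \<infinity>" using fin by (simp add: ennreal_mult_less_top)
  finally have "AE x in lborel. ennreal_powr (?M x) p \<noteq> \<infinity>"
    by (intro nn_integral_PInf_AE) auto
  then show ?thesis
  proof eventually_elim
    case (elim x)
    then have M: "?M x \<noteq> top" by auto
    have "maximal_op R f x \<le> ennreal \<bar>f x\<bar> + ennreal (2 ^ DIM(real^'n)) * ?M x"
      unfolding maximal_op_def
    proof (rule SUP_least)
      fix r assume "r \<in> {0..R x}"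
      then consider "r = 0" | "0 < r" by fastforce
      then show "ball_average f x r \<le> ennreal \<bar>f x\<bar> + ennreal (2 ^ DIM(real^'n)) * ?M x"
      proof cases
        case 1
        then show ?thesis by (simp add: ball_average_def)
      next
        case 2
        then have "ball_average f x r \<le> ennreal ((2 * 1) ^ DIM(real^'n)) * ?M x"
          unfolding ball_average_unit_avg[OF assms(3) 2]
          by (intro unit_avg_le_max_fun[OF net, where h = "\<lambda>x. ennreal \<bar>f x\<bar>"]) auto
        then show ?thesis by (simp add: add_increasing)
      qed
    qed
    also have "\<dots> < top" using M by (simp add: ennreal_mult_less_top less_top)
    finally show ?case by simp
  qed
qed

text \<open>Dividing by \<open>D powr (s * p)\<close> cancels the power of \<open>D\<close> in
  \<open>((4 * D) powr s) powr p\<close>.\<close>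

lemma absdiff_maximal_op_powr_le:
  fixes f :: "real^'n \<Rightarrow> real"
  assumes p: "1 < p" and net: "ball_net I" and f: "f \<in> borel_measurable borel" and G: "open G"
    and R: "\<And>x. x \<in> G \<Longrightarrow> 0 \<le> R x \<and> ball x (R x) \<subseteq> G"
    and x: "x \<in> G" and y: "y \<in> G" and xy: "x \<noteq> y" and s: "0 \<le> s" "s \<le> 2"
    and fin: "maximal_op R f x \<noteq> top"
  shows "ennreal_powr (ennreal_absdiff (maximal_op R f x) (maximal_op R f y)) p
      / ennreal ((norm (x - y) + \<bar>R x - R y\<bar>) powr (s * p))
    \<le> ennreal ((16 * 12 ^ DIM(real^'n)) powr p) * ennreal_powr (diff_bound I (diff_quot G f s) x y) p"
proof -
  define D where "D = norm (x - y) + \<bar>R x - R y\<bar>"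
  have D: "0 < D" using xy by (auto simp: D_def add_pos_nonneg)
  define c where "c = (4 * D) powr s * 12 ^ DIM(real^'n)"
  let ?B = "diff_bound I (diff_quot G f s) x y"
  have c: "0 < c" using D by (simp add: c_def)
  have D': "D = norm (y - x) + \<bar>R y - R x\<bar>" by (simp add: D_def norm_minus_commute abs_minus_commute)
  have "ennreal_absdiff (maximal_op R f x) (maximal_op R f y) \<le> ennreal c * ?B"
  proof (rule ennreal_absdiff_le[OF _ _ fin])
    show "maximal_op R f x \<le> maximal_op R f y + ennreal c * ?B"
      using maximal_op_le[OF net f G R x y xy s(1)] by (simp add: D_def c_def)
    show "maximal_op R f y \<le> maximal_op R f x + ennreal c * ?B"
      using maximal_op_le[OF net f G R y x xy[symmetric] s(1)]
        diff_bound_sym[of "diff_quot G f s", OF diff_quot_sym, of I x y]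
      by (simp add: D'[symmetric] c_def)
  qed
  then have "ennreal_powr (ennreal_absdiff (maximal_op R f x) (maximal_op R f y)) p
      \<le> ennreal (c powr p) * ennreal_powr ?B p"
    using p c ennreal_powr_mono[of p _ "ennreal c * ?B"] by (simp add: ennreal_powr_mult')
  then have "ennreal_powr (ennreal_absdiff (maximal_op R f x) (maximal_op R f y)) p / ennreal (D powr (s * p))
      \<le> (ennreal (c powr p) * ennreal_powr ?B p) / ennreal (D powr (s * p))"
    by (rule divide_right_mono_ennreal)
  also have "\<dots> = ennreal (c powr p / D powr (s * p)) * ennreal_powr ?B p"
    using D by (simp add: divide_ennreal_def inverse_ennreal ennreal_mult mult_ac divide_inverse)
  also have "\<dots> \<le> ennreal ((16 * 12 ^ DIM(real^'n)) powr p) * ennreal_powr ?B p"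
  proof (intro mult_right_mono ennreal_leI)
    have "(4::real) powr s \<le> 4 powr 2" using s by (intro powr_mono) auto
    then have 4: "(4::real) powr s \<le> 16" by simp
    have "c powr p / D powr (s * p) = (4 powr s * 12 ^ DIM(real^'n)) powr p"
      using D by (simp add: c_def powr_mult powr_powr)
    also have "\<dots> \<le> (16 * 12 ^ DIM(real^'n)) powr p"
      using 4 p by (intro powr_mono2 mult_right_mono) auto
    finally show "c powr p / D powr (s * p) \<le> (16 * 12 ^ DIM(real^'n)) powr p" .
  qed auto
  finally show ?thesis by (simp add: D_def)
qed

lemma maximal_op_fractional_bound:
  fixes f w :: "real^'n \<Rightarrow> real"
  assumes p: "1 < p" and A: "0 < A" and w: "ball_Ap p A w"
    and f[measurable]: "f \<in> borel_measurable borel" and G: "open G"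
    and R: "\<And>x. x \<in> G \<Longrightarrow> 0 \<le> R x \<and> ball x (R x) \<subseteq> G"
    and s: "0 \<le> s" "s \<le> 2"
    and fin: "(\<integral>\<^sup>+x. ennreal (\<bar>f x\<bar> powr p) \<partial>lborel) < \<infinity>"
  shows "(\<integral>\<^sup>+x\<in>G. (\<integral>\<^sup>+y\<in>G.
          ennreal_powr (ennreal_absdiff (maximal_op R f x) (maximal_op R f y)) p
            / ennreal ((norm (x - y) + \<bar>R x - R y\<bar>) powr (s * p))
            * ennreal (w (x - y)) \<partial>lborel) \<partial>lborel)
      \<le> ennreal (fractional_bound_const DIM(real^'n) p A) *
        (\<integral>\<^sup>+x\<in>G. (\<integral>\<^sup>+y\<in>G.
          ennreal (\<bar>f x - f y\<bar> powr p / norm (x - y) powr (s * p) * w (x - y))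
          \<partial>lborel) \<partial>lborel)"
proof -
  obtain I :: "((real^'n) \<times> real) set" where net: "ball_net I" using ball_net_exists by blast
  have cI: "countable I" using net by (simp add: ball_net_def)
  have [measurable]: "G \<in> sets borel" using G by simp
  have [measurable]: "w \<in> borel_measurable borel" and wpos: "\<And>x. 0 < w x"
    using w by (auto simp: ball_Ap_def)
  define F where "F = diff_quot G f s"
  have F[measurable]: "case_prod F \<in> borel_measurable (borel \<Otimes>\<^sub>M borel)"
    unfolding F_def by (rule diff_quot_measurable) measurable
  have T[measurable]: "case_prod (max_fst I F) \<in> borel_measurable (borel \<Otimes>\<^sub>M borel)"
    by (rule max_fst_measurable[OF cI F])
  have S[measurable]: "case_prod (max_diag I (max_fst I F)) \<in> borel_measurable (borel \<Otimes>\<^sub>M borel)"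
    by (rule max_diag_measurable[OF cI T])
  have B[measurable]: "case_prod (diff_bound I F) \<in> borel_measurable (borel \<Otimes>\<^sub>M borel)"
    unfolding diff_bound_def[abs_def] case_prod_unfold by measurable
  let ?c = "ennreal ((16 * 12 ^ DIM(real^'n)) powr p)"
  let ?P = "\<lambda>x y. ennreal_powr (ennreal_absdiff (maximal_op R f x) (maximal_op R f y)) p
            / ennreal ((norm (x - y) + \<bar>R x - R y\<bar>) powr (s * p))"
  \<comment> \<open>Passing to the jointly Borel majorant comes first, by monotonicity; linearity
    and Tonelli are applied to the majorant. The exceptional null sets are the points
    \<open>x\<close> with infinite maximal function and, for each \<open>x\<close>, the point
    \<open>y = x\<close>.\<close>
  have "(\<integral>\<^sup>+x\<in>G. (\<integral>\<^sup>+y\<in>G. ?P x y * ennreal (w (x - y)) \<partial>lborel) \<partial>lborel)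
    \<le> (\<integral>\<^sup>+x. (\<integral>\<^sup>+y. ?c * (ennreal_powr (diff_bound I F x y) p * ennreal (w (x - y))) \<partial>lborel) \<partial>lborel)"
  proof (rule nn_integral_mono_AE)
    show "AE x in lborel. (\<integral>\<^sup>+y\<in>G. ?P x y * ennreal (w (x - y)) \<partial>lborel) * indicator G x
      \<le> (\<integral>\<^sup>+y. ?c * (ennreal_powr (diff_bound I F x y) p * ennreal (w (x - y))) \<partial>lborel)"
      using maximal_op_finite_AE[OF p net f fin, of R]
    proof eventually_elim
      case (elim x)
      show ?case
      proof (cases "x \<in> G")
        case True
        have "(\<integral>\<^sup>+y\<in>G. ?P x y * ennreal (w (x - y)) \<partial>lborel)
          \<le> (\<integral>\<^sup>+y. ?c * (ennreal_powr (diff_bound I F x y) p * ennreal (w (x - y))) \<partial>lborel)"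
        proof (rule nn_integral_mono_AE)
          show "AE y in lborel. ?P x y * ennreal (w (x - y)) * indicator G y
            \<le> ?c * (ennreal_powr (diff_bound I F x y) p * ennreal (w (x - y)))"
            using AE_lborel_singleton[of x]
          proof eventually_elim
            case (elim y)
            show ?case
            proof (cases "y \<in> G")
              case y: True
              have "?P x y \<le> ?c * ennreal_powr (diff_bound I F x y) p"
                unfolding F_def
                by (rule absdiff_maximal_op_powr_le[OF p net f G R True y elim[symmetric] s \<open>maximal_op R f x \<noteq> top\<close>])
              from mult_right_mono[OF this, of "ennreal (w (x - y))"] show ?thesis
                using y by (simp add: mult.assoc)
            qed simp
          qed
        qed
        then show ?thesis using True by simp
      qed simp
    qed
  qed
  also have "\<dots> = ?c * (\<integral>\<^sup>+x. (\<integral>\<^sup>+y. ennreal_powr (diff_bound I F x y) p * ennreal (w (x - y)) \<partial>lborel) \<partial>lborel)"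
  proof -
    have "(\<integral>\<^sup>+x. (\<integral>\<^sup>+y. ?c * (ennreal_powr (diff_bound I F x y) p * ennreal (w (x - y))) \<partial>lborel) \<partial>lborel)
      = (\<integral>\<^sup>+x. ?c * (\<integral>\<^sup>+y. ennreal_powr (diff_bound I F x y) p * ennreal (w (x - y)) \<partial>lborel) \<partial>lborel)"
      by (intro nn_integral_cong nn_integral_cmult) measurable
    also have "\<dots> = ?c * (\<integral>\<^sup>+x. (\<integral>\<^sup>+y. ennreal_powr (diff_bound I F x y) p * ennreal (w (x - y)) \<partial>lborel) \<partial>lborel)"
      by (rule nn_integral_cmult) measurable
    finally show ?thesis .
  qed
  also have "\<dots> \<le> ?c * (ennreal (diff_bound_const DIM(real^'n) p A) *
      (\<integral>\<^sup>+x. (\<integral>\<^sup>+y. ennreal_powr (F x y) p * ennreal (w (x - y)) \<partial>lborel) \<partial>lborel))"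
    by (intro mult_left_mono diff_bound_strong_type[OF p A w net F]) (auto simp: F_def diff_quot_sym)
  also have "(\<integral>\<^sup>+x. (\<integral>\<^sup>+y. ennreal_powr (F x y) p * ennreal (w (x - y)) \<partial>lborel) \<partial>lborel)
    = (\<integral>\<^sup>+x\<in>G. (\<integral>\<^sup>+y\<in>G.
          ennreal (\<bar>f x - f y\<bar> powr p / norm (x - y) powr (s * p) * w (x - y))
          \<partial>lborel) \<partial>lborel)"
  proof (rule nn_integral_cong)
    fix x
    show "(\<integral>\<^sup>+y. ennreal_powr (F x y) p * ennreal (w (x - y)) \<partial>lborel)
      = (\<integral>\<^sup>+y\<in>G. ennreal (\<bar>f x - f y\<bar> powr p / norm (x - y) powr (s * p) * w (x - y)) \<partial>lborel) * indicator G x"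
    proof (cases "x \<in> G")
      case True
      have "ennreal_powr (F x y) p * ennreal (w (x - y))
        = ennreal (\<bar>f x - f y\<bar> powr p / norm (x - y) powr (s * p) * w (x - y)) * indicator G y" for y
      proof (cases "y \<in> G")
        case y: True
        then show ?thesis
          unfolding F_def diff_quot_powr[OF True y] using less_imp_le[OF wpos[of "x - y"]]
          by (subst ennreal_mult[symmetric]) auto
      qed (simp add: F_def diff_quot_def)
      then show ?thesis using True by simp
    qed (simp add: F_def diff_quot_def)
  qed
  finally show ?thesis
    by (simp add: fractional_bound_const_def ennreal_mult' mult.assoc)
qed

section \<open>Domain and weight in terms of balls and Borel functions\<close>

text \<open>A ball is connected, so if it contained points inside and outside \<open>G\<close> it
  would contain a boundary point, at distance less than \<open>r\<close>.\<close>

lemma ball_subset_of_dist_boundary: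
  fixes G :: "'a::real_normed_vector set"
  assumes "x \<in> G" "ereal r \<le> dist_boundary x G"
  shows "ball x r \<subseteq> G"
proof (rule ccontr)
  assume n: "\<not> ball x r \<subseteq> G"
  then have r: "0 < r" using ball_empty[of r x] by (metis empty_subsetI not_le)
  have "G \<noteq> UNIV" using n by auto
  then have le: "r \<le> infdist x (frontier G)" using assms by (simp add: dist_boundary_def)
  have "ball x r \<inter> frontier G \<noteq> {}"
    using n centre_in_ball[of x r] r assms(1) by (intro connected_Int_frontier connected_ball) blast+
  then obtain z where "z \<in> frontier G" "dist x z < r" by auto
  with infdist_le[of z "frontier G" x] le show False by simp
qed

text \<open>The map \<open>y \<mapsto> x - y\<close> preserves null sets, so changing the weight on
  a null set is invisible in the inner integral for every \<open>x\<close>.\<close>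

lemma AE_lborel_reflect:
  fixes x :: "'a::euclidean_space"
  assumes "AE z in lborel. P z"
  shows "AE y in lborel. P (x - y)"
proof -
  obtain N where N: "{z\<in>space lborel. \<not> P z} \<subseteq> N" "emeasure lborel N = 0" "N \<in> sets lborel"
    using AE_E[OF assms] by metis
  have [measurable]: "N \<in> sets borel" using N by simp
  have "0 = (\<integral>\<^sup>+z. indicator N z \<partial>lborel)" using N by simp
  also have "\<dots> = (\<integral>\<^sup>+y. indicator N (x + (-1) *\<^sub>R y) \<partial>lborel)"
    by (subst nn_integral_lborel_affine[of _ "-1" x]) auto
  finally have "(\<integral>\<^sup>+y. indicator N (x - y) \<partial>lborel) = (0::ennreal)" by simp
  then have "AE y in lborel. indicator N (x - y) = (0::ennreal)"
    by (subst (asm) nn_integral_0_iff_AE) auto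
  then show ?thesis
    by eventually_elim (use N(1) in \<open>auto simp: indicator_def split: if_splits\<close>)
qed

text \<open>Restrictions to growing balls are integrable and converge to the weight, which is
  therefore Lebesgue measurable. A Borel version is positive up to a null set, where it is reset to
  1.\<close>

lemma weight_borel_version:
  fixes \<omega> :: "real^'n \<Rightarrow> real"
  assumes "weight \<omega>"
  obtains w where "w \<in> borel_measurable borel" "\<And>x. 0 < w x" "AE x in lborel. \<omega> x = w x"
proof -
  have "(\<lambda>x. indicator (cball 0 (real n)) x *\<^sub>R \<omega> x) \<in> borel_measurable lebesgue" for n
  proof -
    have "set_integrable lebesgue (cball 0 (real n)) \<omega>" using assms by (simp add: weight_def)
    then show ?thesis unfolding set_integrable_def by (rule borel_measurable_integrable)
  qed
  moreover have "(\<lambda>n. indicator (cball 0 (real n)) x *\<^sub>R \<omega> x) \<longlonglongrightarrow> \<omega> x" for x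
  proof (rule tendsto_eventually)
    obtain N :: nat where "norm x \<le> real N" using real_arch_simple by blast
    then show "\<forall>\<^sub>F n in sequentially. indicator (cball 0 (real n)) x *\<^sub>R \<omega> x = \<omega> x"
      by (intro eventually_sequentiallyI[of N]) auto
  qed
  ultimately have "\<omega> \<in> borel_measurable lebesgue" by (rule borel_measurable_LIMSEQ_real[rotated])
  then obtain g where g[measurable]: "g \<in> borel_measurable lborel" and ae: "AE x in lborel. \<omega> x = g x"
    using completion_ex_borel_measurable_real by blast
  have "AE x in lborel. \<omega> x > 0" using assms by (simp add: weight_def AE_completion_iff)
  with ae have "AE x in lborel. \<omega> x = (if 0 < g x then g x else 1)" by eventually_elim auto
  moreover have "(\<lambda>x. if 0 < g x then g x else 1) \<in> borel_measurable lborel" by measurable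
  ultimately show ?thesis by (intro that[of "\<lambda>x. if 0 < g x then g x else 1"]) auto
qed

lemma emeasure_lborel_cube:
  assumes "0 \<le> l"
  shows "emeasure lborel (cube a l :: (real^'n) set) = ennreal (l ^ CARD('n))"
proof -
  have "emeasure lborel (cube a l) = ennreal (measure lborel (cube a l))"
    unfolding cube_def by (intro emeasure_eq_ennreal_measure) (simp add: emeasure_lborel_cbox_eq)
  also have "measure lborel (cube a l) = l ^ CARD('n)"
    using assms unfolding cube_def by (subst content_cbox_cart) (auto simp: interval_ne_empty_cart)
  finally show ?thesis .
qed

text \<open>The ball lies in the concentric cube of side \<open>2 * r\<close>, and both integrals
  grow when passing to it. The volumes have the fixed ratio \<open>2 ^ CARD('n) / V1\<close>, where
  \<open>V1\<close> is the volume of the unit ball; it enters with power \<open>p\<close>.\<close>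

lemma Ap_bound_imp_ball_Ap:
  fixes \<omega> w :: "real^'n \<Rightarrow> real"
  assumes p: "1 < p" and A: "0 < A" and weight: "weight \<omega>" and Ap: "Ap_bound p \<omega> A"
    and [measurable]: "w \<in> borel_measurable borel" and wpos: "\<And>x. 0 < w x"
    and ae: "AE x in lborel. \<omega> x = w x"
  shows "ball_Ap p (A * (2 ^ CARD('n) / measure lborel (ball (0 :: real^'n) 1)) powr p) w"
  unfolding ball_Ap_def
proof (intro conjI allI impI)
  fix x :: "real^'n" and r :: real assume r: "0 < r"
  define Q where "Q = cube (x - (\<chi> i. r)) (2 * r)"
  have [measurable]: "Q \<in> sets borel" by (simp add: Q_def cube_def)
  have sub: "ball x r \<subseteq> Q"
  proof
    fix z assume "z \<in> ball x r"
    then have n: "norm (x - z) < r" by (simp add: dist_norm)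
    have "\<bar>x $ i - z $ i\<bar> < r" for i
      using component_le_norm_cart[of "x - z" i] n by simp
    then have "x $ i - r \<le> z $ i" "z $ i \<le> r + x $ i" for i by (smt (verit))+
    then show "z \<in> Q" by (auto simp: Q_def cube_def mem_box_cart)
  qed
  define v where "v = (2 * r) ^ CARD('n)"
  have v: "0 < v" "emeasure lborel Q = ennreal v"
    using r by (auto simp: v_def Q_def emeasure_lborel_cube)
  \<comment> \<open>A zero integral of a positive function would make the ball a null set.\<close>
  have pos: "0 < (\<integral>\<^sup>+y\<in>ball x r. ennreal (g y) \<partial>lborel)"
    if [measurable]: "g \<in> borel_measurable borel" and g: "\<And>y. 0 < g y" for g
  proof (rule ccontr)
    assume "\<not> 0 < (\<integral>\<^sup>+y\<in>ball x r. ennreal (g y) \<partial>lborel)"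
    then have "(\<integral>\<^sup>+y\<in>ball x r. ennreal (g y) \<partial>lborel) = 0" by simp
    then have "AE y in lborel. ennreal (g y) * indicator (ball x r) y = 0"
      by (subst (asm) nn_integral_0_iff_AE) auto
    then have "AE y in lborel. y \<notin> ball x r"
      by eventually_elim (use g[unfolded not_le[symmetric]] in \<open>auto simp: indicator_def ennreal_eq_0_iff split: if_splits\<close>)
    then have "emeasure lborel (ball x r) = 0"
      by (subst (asm) AE_iff_measurable[of "ball x r"]) auto
    then show False using r by (simp add: emeasure_lborel_ball content_ball_pos less_imp_neq[THEN not_sym])
  qed
  define a where "a = enn2real (\<integral>\<^sup>+y\<in>Q. ennreal (w y) \<partial>lborel)"
  have ea: "(\<integral>\<^sup>+y\<in>Q. ennreal (w y) \<partial>lborel) = ennreal a"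
  proof -
    have "compact Q" by (simp add: Q_def cube_def compact_cbox)
    then have "set_integrable lebesgue Q \<omega>" using weight by (simp add: weight_def)
    then have "(\<integral>\<^sup>+y. ennreal (norm (indicator Q y *\<^sub>R \<omega> y)) \<partial>lebesgue) < \<infinity>"
      by (simp add: set_integrable_def integrable_iff_bounded)
    moreover have "(\<integral>\<^sup>+y. ennreal (norm (indicator Q y *\<^sub>R \<omega> y)) \<partial>lebesgue) = (\<integral>\<^sup>+y\<in>Q. ennreal (w y) \<partial>lborel)"
      unfolding nn_integral_completion
      using ae by (intro nn_integral_cong_AE, eventually_elim)
        (use wpos in \<open>auto simp: indicator_def less_imp_le\<close>)
    ultimately show ?thesis by (simp add: a_def)
  qed
  have avg: "cube_average g Q = (\<integral>\<^sup>+y\<in>Q. ennreal (h y) \<partial>lborel) / ennreal v"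
    if "AE y in lborel. g y = h y" for g h
  proof -
    have "(\<integral>\<^sup>+y\<in>Q. ennreal (g y) \<partial>lborel) = (\<integral>\<^sup>+y\<in>Q. ennreal (h y) \<partial>lborel)"
      using that by (intro nn_integral_cong_AE, eventually_elim) simp
    then show ?thesis using v by (simp add: cube_average_def nn_integral_completion)
  qed
  have \<omega>Q: "cube_average \<omega> Q = ennreal a / ennreal v"
    using avg[OF ae] by (simp add: ea)
  have "AE y in lborel. \<omega> y powr (- 1 / (p - 1)) = dual_weight p w y"
    using ae unfolding dual_weight_def by eventually_elim simp
  then have dual: "cube_average (\<lambda>x. \<omega> x powr (- 1 / (p - 1))) Q
    = (\<integral>\<^sup>+y\<in>Q. ennreal (dual_weight p w y) \<partial>lborel) / ennreal v" (is "_ = ?b / _")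
    by (rule avg)
  have "0 < 2 * r" using r by simp
  then have Aw: "ennreal a / ennreal v * ennreal_powr (?b / ennreal v) (p - 1) \<le> ennreal A"
    using Ap unfolding Ap_bound_def Q_def[symmetric] \<omega>Q[symmetric] dual[symmetric] by (auto simp: Q_def)
  have wle: "(\<integral>\<^sup>+y\<in>ball x r. ennreal (w y) \<partial>lborel) \<le> ennreal a"
    unfolding ea[symmetric] using subsetD[OF sub]
    by (intro nn_integral_mono) (auto simp: indicator_def simp del: mem_ball)
  have dpos: "0 < dual_weight p w y" for y by (simp add: dual_weight_pos wpos)
  have a: "0 < a" using less_le_trans[OF pos[of w] wle] wpos by simp
  \<comment> \<open>The average of the weight itself is positive, so an infinite dual average would
    make the product infinite.\<close>
  have bfin: "?b \<noteq> top"
  proof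
    assume "?b = top"
    then have "ennreal a / ennreal v * ennreal_powr (?b / ennreal v) (p - 1) = top"
      using a v by (simp add: ennreal_top_divide divide_ennreal ennreal_mult_top)
    with Aw show False by (simp add: top_unique)
  qed
  define b where "b = enn2real ?b"
  have eb: "?b = ennreal b" using bfin by (simp add: b_def less_top)
  have b0: "0 \<le> b" by (simp add: b_def)
  have dle: "(\<integral>\<^sup>+y\<in>ball x r. ennreal (dual_weight p w y) \<partial>lborel) \<le> ennreal b"
    unfolding eb[symmetric] using subsetD[OF sub]
    by (intro nn_integral_mono) (auto simp: indicator_def simp del: mem_ball)
  have "ennreal (a / v * (b / v) powr (p - 1)) \<le> ennreal A"
    using Aw a b0 v by (subst ennreal_mult) (simp_all add: eb divide_ennreal)
  then have "a / v * (b / v) powr (p - 1) \<le> A" using A by (simp add: ennreal_le_iff)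
  then have ab: "a * b powr (p - 1) \<le> A * v powr p"
    using v b0 powr_add[of v "p - 1" 1] by (simp add: powr_divide field_simps)
  define W where "W = enn2real (\<integral>\<^sup>+y\<in>ball x r. ennreal (w y) \<partial>lborel)"
  define S where "S = enn2real (\<integral>\<^sup>+y\<in>ball x r. ennreal (dual_weight p w y) \<partial>lborel)"
  have W: "(\<integral>\<^sup>+y\<in>ball x r. ennreal (w y) \<partial>lborel) = ennreal W"
    using wle by (simp add: W_def le_less_trans[OF wle])
  have S: "(\<integral>\<^sup>+y\<in>ball x r. ennreal (dual_weight p w y) \<partial>lborel) = ennreal S"
    using dle by (simp add: S_def le_less_trans[OF dle])
  have "0 < W" using pos[of w] wpos by (simp add: W)
  have "0 < S" using pos[of "dual_weight p w"] dpos by (simp add: S)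
  have "W \<le> a" using wle a by (simp add: W)
  have "S \<le> b" using dle b0 by (simp add: S)
  define V1 where "V1 = measure lborel (ball (0 :: real^'n) 1)"
  have V1: "0 < V1" by (simp add: V1_def content_ball_pos)
  have "v = 2 ^ CARD('n) / V1 * measure lborel (ball x r)"
    using content_ball_scale[of 1 r x "0 :: real^'n"] r V1 by (simp add: v_def V1_def[symmetric] power_mult_distrib)
  then have "v powr p = (2 ^ CARD('n) / V1) powr p * measure lborel (ball x r) powr p"
    using V1 by (subst powr_mult[symmetric]) auto
  moreover have "W * S powr (p - 1) \<le> a * b powr (p - 1)"
    using \<open>0 < W\<close> \<open>0 < S\<close> \<open>W \<le> a\<close> \<open>S \<le> b\<close> p by (intro mult_mono powr_mono2) auto
  ultimately have "W * S powr (p - 1) \<le> A * (2 ^ CARD('n) / V1) powr p * measure lborel (ball x r) powr p"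
    using ab by (simp add: mult.assoc)
  then show "\<exists>W S. 0 < W \<and> 0 < S \<and> (\<integral>\<^sup>+y\<in>ball x r. ennreal (w y) \<partial>lborel) = ennreal W \<and>
    (\<integral>\<^sup>+y\<in>ball x r. ennreal (dual_weight p w y) \<partial>lborel) = ennreal S \<and>
    W * S powr (p - 1) \<le> A * (2 ^ CARD('n) / measure lborel (ball (0 :: real^'n) 1)) powr p
      * measure lborel (ball x r) powr p"
    using W S \<open>0 < W\<close> \<open>0 < S\<close> unfolding V1_def by blast
qed (use wpos in auto)

subsection \<open>Reduction to Borel functions\<close>

text \<open>Besides being Borel, \<open>g\<close> vanishes outside \<open>G\<close>, so its
  \<open>p\<close>-norm over the whole space is finite and maximal theorems there apply.\<close>

lemma Lp_on_borel_version:
  fixes f :: "real^'n \<Rightarrow> real"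
  assumes f: "f \<in> Lp_on p G" and [measurable]: "G \<in> sets borel"
  obtains g where "g \<in> borel_measurable borel" "AE x in lborel. x \<in> G \<longrightarrow> f x = g x"
    "(\<integral>\<^sup>+x. ennreal (\<bar>g x\<bar> powr p) \<partial>lborel) < \<infinity>"
proof -
  have Gl: "G \<in> sets lebesgue" using assms(2) by simp
  have "(\<lambda>x. f x * indicator G x) \<in> borel_measurable lebesgue"
    using f Gl borel_measurable_restrict_space_iff[of G lebesgue f]
    by (simp add: Lp_on_def mult.commute)
  then obtain h where [measurable]: "h \<in> borel_measurable lborel"
    and h: "AE x in lborel. f x * indicator G x = h x"
    using completion_ex_borel_measurable_real by blast
  have ae: "AE x in lborel. x \<in> G \<longrightarrow> f x = h x * indicator G x"
    using h by eventually_elim auto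
  have "(\<integral>\<^sup>+x. ennreal (\<bar>h x * indicator G x\<bar> powr p) \<partial>lborel)
      = (\<integral>\<^sup>+x\<in>G. ennreal (\<bar>f x\<bar> powr p) \<partial>lborel)"
    using ae by (intro nn_integral_cong_AE, eventually_elim) (auto simp: indicator_def)
  also have "\<dots> < \<infinity>" using f by (simp add: Lp_on_def nn_integral_completion)
  finally show ?thesis using ae by (intro that[of "\<lambda>x. h x * indicator G x"]) auto
qed

text \<open>Averages with positive radius ignore null sets, and their balls stay in
  \<open>G\<close>; the radius 0 restricts the equality to points where \<open>f\<close> and
  \<open>g\<close> agree.\<close>

lemma maximal_op_cong_AE:
  fixes f g :: "real^'n \<Rightarrow> real"
  assumes "AE x in lborel. x \<in> G \<longrightarrow> f x = g x" and R: "\<And>x. x \<in> G \<Longrightarrow> ball x (R x) \<subseteq> G"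
  shows "AE x in lborel. x \<in> G \<longrightarrow> maximal_op R f x = maximal_op R g x"
  using assms(1)
proof eventually_elim
  case (elim x)
  show ?case
  proof
    assume x: "x \<in> G"
    have "ball_average f x r = ball_average g x r" if r: "r \<in> {0..R x}" for r
    proof (cases "r = 0")
      case True
      then show ?thesis using elim x by (simp add: ball_average_def)
    next
      case False
      have sub: "ball x r \<subseteq> G" using R[OF x] r subset_ball[of r "R x" x] by auto
      have "(\<integral>\<^sup>+y\<in>ball x r. ennreal \<bar>f y\<bar> \<partial>lborel) = (\<integral>\<^sup>+y\<in>ball x r. ennreal \<bar>g y\<bar> \<partial>lborel)"
        using assms(1)
        by (intro nn_integral_cong_AE, eventually_elim)
          (use subsetD[OF sub] in \<open>auto simp: indicator_def simp del: mem_ball\<close>)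
      then show ?thesis using False by (simp add: ball_average_lborel)
    qed
    then show "maximal_op R f x = maximal_op R g x"
      unfolding maximal_op_def by (intro SUP_cong refl)
  qed
qed

text \<open>\<open>P\<close> collects what fails on a null set of either variable, \<open>Q\<close>
  what fails, for each \<open>x\<close>, on a null set of \<open>y\<close>.\<close>

lemma set_nn_integral2_cong_AE:
  assumes "AE x in lborel. x \<in> G \<longrightarrow> P x" and Q: "\<And>x. AE y in lborel. Q x y"
    and "\<And>x y. x \<in> G \<Longrightarrow> y \<in> G \<Longrightarrow> P x \<Longrightarrow> P y \<Longrightarrow> Q x y \<Longrightarrow> H x y = K x y"
  shows "(\<integral>\<^sup>+x\<in>G. (\<integral>\<^sup>+y\<in>G. H x y \<partial>lborel) \<partial>lborel) = (\<integral>\<^sup>+x\<in>G. (\<integral>\<^sup>+y\<in>G. K x y \<partial>lborel) \<partial>lborel)"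
proof (rule nn_integral_cong_AE)
  show "AE x in lborel. (\<integral>\<^sup>+y\<in>G. H x y \<partial>lborel) * indicator G x = (\<integral>\<^sup>+y\<in>G. K x y \<partial>lborel) * indicator G x"
    using assms(1)
  proof eventually_elim
    case (elim x)
    show ?case
    proof (cases "x \<in> G")
      case True
      with elim have "P x" by simp
      have "(\<integral>\<^sup>+y\<in>G. H x y \<partial>lborel) = (\<integral>\<^sup>+y\<in>G. K x y \<partial>lborel)"
        using assms(1) Q[of x]
        by (intro nn_integral_cong_AE, eventually_elim)
          (use assms(3) True \<open>P x\<close> in \<open>auto simp: indicator_def\<close>)
      then show ?thesis by simp
    qed simp
  qed
qed

lemma Ap_bound_mono:
  assumes "Ap_bound p \<omega> A" "A \<le> B"
  shows "Ap_bound p \<omega> B"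
  using assms unfolding Ap_bound_def by (meson ennreal_leI order_trans)

text \<open>A number above the infimum exceeds some admissible constant, and admissibility passes to
  larger numbers.\<close>

lemma Ap_bound_less_const:
  assumes "Ap_weight p \<omega>" "Ap_const p \<omega> < B"
  shows "0 < B \<and> Ap_bound p \<omega> B"
proof -
  have "{A. 0 < A \<and> Ap_bound p \<omega> A} \<noteq> {}" using assms(1) by (auto simp: Ap_weight_def)
  from cInf_lessD[OF this, of B] assms(2) obtain A where "0 < A" "Ap_bound p \<omega> A" "A < B"
    by (auto simp: Ap_const_def)
  then show ?thesis using Ap_bound_mono[of p \<omega> A B] by simp
qed

theorem theorem4p1:
  fixes p K :: real
  assumes "1 < p"
  shows "\<exists>C>0. \<forall>(G :: (real^'n) set) (s :: real) (R :: real^'n \<Rightarrow> real) (\<omega> :: real^'n \<Rightarrow> real).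
    open G \<and> G \<noteq> {} \<and> 0 \<le> s \<and> s \<le> 2 \<and>
    R \<in> borel_measurable (lebesgue_on G) \<and>
    (\<forall>x\<in>G. 0 \<le> R x \<and> ereal (R x) \<le> dist_boundary x G) \<and>
    Ap_weight p \<omega> \<and> Ap_const p \<omega> = K \<longrightarrow>
    (\<forall>f\<in>Lp_on p G.
      (\<integral>\<^sup>+x\<in>G. (\<integral>\<^sup>+y\<in>G.
          ennreal_powr (ennreal_absdiff (maximal_op R f x) (maximal_op R f y)) p
            / ennreal ((norm (x - y) + \<bar>R x - R y\<bar>) powr (s * p))
            * ennreal (\<omega> (x - y)) \<partial>lebesgue) \<partial>lebesgue)
      \<le> ennreal C *
        (\<integral>\<^sup>+x\<in>G. (\<integral>\<^sup>+y\<in>G.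
          ennreal (\<bar>f x - f y\<bar> powr p / norm (x - y) powr (s * p) * \<omega> (x - y))
          \<partial>lebesgue) \<partial>lebesgue))"
proof -
  let ?n = "DIM(real^'n)"
  \<comment> \<open>Using \<open>K + 1\<close> avoids showing that the infimum \<open>K\<close> is
    attained; the second factor is the price of passing from cubes to balls.\<close>
  define A where "A = (K + 1) * (2 ^ CARD('n) / measure lborel (ball (0 :: real^'n) 1)) powr p"
  define C where "C = max 1 (fractional_bound_const ?n p A)"
  have "0 < C" by (simp add: C_def)
  moreover have "(\<integral>\<^sup>+x\<in>G. (\<integral>\<^sup>+y\<in>G.
          ennreal_powr (ennreal_absdiff (maximal_op R f x) (maximal_op R f y)) p
            / ennreal ((norm (x - y) + \<bar>R x - R y\<bar>) powr (s * p))
            * ennreal (\<omega> (x - y)) \<partial>lebesgue) \<partial>lebesgue)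
      \<le> ennreal C *
        (\<integral>\<^sup>+x\<in>G. (\<integral>\<^sup>+y\<in>G.
          ennreal (\<bar>f x - f y\<bar> powr p / norm (x - y) powr (s * p) * \<omega> (x - y))
          \<partial>lebesgue) \<partial>lebesgue)"
    if G: "open G" and s: "0 \<le> s" "s \<le> 2"
      and R: "\<forall>x\<in>G. 0 \<le> R x \<and> ereal (R x) \<le> dist_boundary x G"
      and \<omega>: "Ap_weight p \<omega>" "Ap_const p \<omega> = K" and f: "f \<in> Lp_on p G"
    for G :: "(real^'n) set" and s :: real and R \<omega> f :: "real^'n \<Rightarrow> real"
  proof -
    have R': "0 \<le> R x \<and> ball x (R x) \<subseteq> G" if "x \<in> G" for x
      using R that ball_subset_of_dist_boundary[of x G "R x"] by auto
    have K: "0 < K + 1" "Ap_bound p \<omega> (K + 1)"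
      using Ap_bound_less_const[OF \<omega>(1), of "K + 1"] \<omega>(2) by auto
    have weight: "weight \<omega>" using \<omega>(1) by (simp add: Ap_weight_def)
    obtain w where w: "w \<in> borel_measurable borel" "\<And>x. 0 < w x" and \<omega>w: "AE x in lborel. \<omega> x = w x"
      by (rule weight_borel_version[OF weight]) (rule that)
    have Aw: "ball_Ap p A w"
      unfolding A_def by (rule Ap_bound_imp_ball_Ap[OF assms K(1) weight K(2) w \<omega>w])
    have A: "0 < A" unfolding A_def using K(1) by (simp add: content_ball_pos)
    have "G \<in> sets borel" using G by simp
    from Lp_on_borel_version[OF f this] obtain g where g: "g \<in> borel_measurable borel"
      and fg: "AE x in lborel. x \<in> G \<longrightarrow> f x = g x"
      and fin: "(\<integral>\<^sup>+x. ennreal (\<bar>g x\<bar> powr p) \<partial>lborel) < \<infinity>" .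
    have "AE x in lborel. x \<in> G \<longrightarrow> maximal_op R f x = maximal_op R g x"
      using R' by (intro maximal_op_cong_AE[OF fg]) auto
    then have eq: "AE x in lborel. x \<in> G \<longrightarrow> f x = g x \<and> maximal_op R f x = maximal_op R g x"
      using fg by eventually_elim simp
    have "AE y in lborel. \<omega> (x - y) = w (x - y)" for x
      by (rule AE_lborel_reflect[OF \<omega>w])
    \<comment> \<open>One rule serves both sides of the inequality: the integrands depend on
      \<open>f\<close>, its maximal function and the weight only through values that agree off these
      null sets.\<close>
    note eq2 = set_nn_integral2_cong_AE[where Q = "\<lambda>x y. \<omega> (x - y) = w (x - y)", OF eq this]
    have "(\<integral>\<^sup>+x\<in>G. (\<integral>\<^sup>+y\<in>G.
          ennreal_powr (ennreal_absdiff (maximal_op R f x) (maximal_op R f y)) p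
            / ennreal ((norm (x - y) + \<bar>R x - R y\<bar>) powr (s * p))
            * ennreal (\<omega> (x - y)) \<partial>lebesgue) \<partial>lebesgue)
      = (\<integral>\<^sup>+x\<in>G. (\<integral>\<^sup>+y\<in>G.
          ennreal_powr (ennreal_absdiff (maximal_op R g x) (maximal_op R g y)) p
            / ennreal ((norm (x - y) + \<bar>R x - R y\<bar>) powr (s * p))
            * ennreal (w (x - y)) \<partial>lborel) \<partial>lborel)"
      unfolding nn_integral_completion by (rule eq2) simp
    also have "\<dots> \<le> ennreal (fractional_bound_const ?n p A) *
        (\<integral>\<^sup>+x\<in>G. (\<integral>\<^sup>+y\<in>G.
          ennreal (\<bar>g x - g y\<bar> powr p / norm (x - y) powr (s * p) * w (x - y))
          \<partial>lborel) \<partial>lborel)"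
      by (rule maximal_op_fractional_bound[OF assms A Aw g G R' s fin])
    also have "\<dots> \<le> ennreal C *
        (\<integral>\<^sup>+x\<in>G. (\<integral>\<^sup>+y\<in>G.
          ennreal (\<bar>g x - g y\<bar> powr p / norm (x - y) powr (s * p) * w (x - y))
          \<partial>lborel) \<partial>lborel)"
      by (intro mult_right_mono ennreal_leI) (auto simp: C_def)
    also have "(\<integral>\<^sup>+x\<in>G. (\<integral>\<^sup>+y\<in>G.
          ennreal (\<bar>g x - g y\<bar> powr p / norm (x - y) powr (s * p) * w (x - y))
          \<partial>lborel) \<partial>lborel)
      = (\<integral>\<^sup>+x\<in>G. (\<integral>\<^sup>+y\<in>G.
          ennreal (\<bar>f x - f y\<bar> powr p / norm (x - y) powr (s * p) * \<omega> (x - y))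
          \<partial>lebesgue) \<partial>lebesgue)"
      unfolding nn_integral_completion by (rule eq2[symmetric]) simp
    finally show ?thesis .
  qed
  ultimately show ?thesis by blast
qed

end
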